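(* Let $D$ be a Dirac-type operator whose infinitesimal equivariance defect defines a map $\delta_D:\mathfrak g\to\mathfrak{gl}_{\mathrm{res}}(H)$, $\delta_D(\xi)=[\mathcal L_{\xi^\#},D]$, and let $c_D(\xi,\eta)=c_{\mathrm{Sch}}(\delta_D(\xi),\delta_D(\eta))$ for $\xi,\eta\in\mathfrak g$. If $\delta_D$ is a Lie algebra morphism into $\mathfrak{gl}_{\mathrm{res}}(H)$, then $c_D$ is a Lie algebra $2$-cocycle on $\mathfrak g$.
   Context: $H=H_+\oplus H_-$ is a polarized complex Hilbert space. For $A\in\mathcal B(H)$, $A_{-+}:H_+\to H_-$ and $A_{+-}:H_-\to H_+$ are its off-diagonal blocks. $\mathfrak{gl}_{\mathrm{res}}(H)=\{A\in\mathcal B(H): A_{+-},A_{-+}\text{ Hilbert--Schmidt}\}$, with the commutator bracket. The Schwinger cocycle is $c_{\mathrm{Sch}}(A,B)=\operatorname{Tr}(A_{-+}B_{+-}-B_{-+}A_{+-})$ for $A,B\in\mathfrak{gl}_{\mathrm{res}}(H)$. $G$ is a regular diffeological Lie group with Lie algebra $\mathfrak g$, acting on the spherical Milnor space $E^{\mathrm{sph}}(G)$ (the space of classes $[(x_i,g_i)_{i\in\mathbb N}]$, $x_i\in\mathbb R$ finitely supported with $\sum x_i^2=1$, $g_i\in G$ relevant only when $x_i\ne0$) by $h\cdot[(x_i,g_i)]=[(x_i,hg_i)]$; it is assumed that fundamental vector fields $\xi^\#$ and their Lie derivatives $\mathcal L_{\xi^\#}$ on sections of the Clifford module $\mathcal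 E\to E^{\mathrm{sph}}(G)$ on which $D$ acts are well-defined. The defect operators $[\mathcal L_{\xi^\#},D]$ are assumed to define elements of $\mathfrak{gl}_{\mathrm{res}}(H)$ on the relevant polarized Hilbert module $H$. A Lie algebra $2$-cocycle on $\mathfrak g$ is a skew-symmetric bilinear map $c:\mathfrak g\times\mathfrak g\to\mathbb C$ with $c([\xi,\eta],\zeta)+c([\eta,\zeta],\xi)+c([\zeta,\xi],\eta)=0$. *)

theory Defs
  imports "HOL-Analysis.Analysis" "HOL-Algebra.Group"
begin

section \<open>Diffeological spaces\<close>

text \<open>The dimension of a plot domain varies within a single diffeology, so Euclidean space of
  dimension \<open>n\<close> is the set of real sequences vanishing from index \<open>n\<close> on, with the
  (product) topology inherited from \<open>nat \<Rightarrow> real\<close>; this subspace topology is the usual one.\<close>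

definition euc :: "nat \<Rightarrow> (nat \<Rightarrow> real) set" where
  "euc n = {x. \<forall>i\<ge>n. x i = 0}"

definition open_dom :: "nat \<Rightarrow> (nat \<Rightarrow> real) set \<Rightarrow> bool" where
  "open_dom n U \<longleftrightarrow> openin (top_of_set (euc n)) U"

definition partial_deriv :: "nat \<Rightarrow> ((nat \<Rightarrow> real) \<Rightarrow> real) \<Rightarrow> (nat \<Rightarrow> real) \<Rightarrow> real" where
  "partial_deriv i f x = deriv (\<lambda>t. f (x(i := t))) (x i)"

primrec Ck_on :: "nat \<Rightarrow> nat \<Rightarrow> (nat \<Rightarrow> real) set \<Rightarrow> ((nat \<Rightarrow> real) \<Rightarrow> real) \<Rightarrow> bool" where
  "Ck_on n 0 U f = continuous_on U f"
| "Ck_on n (Suc k) U f = (continuous_on U f \<and>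
     (\<forall>i<n. (\<forall>x\<in>U. (\<lambda>t. f (x(i := t))) differentiable (at (x i))) \<and>
            Ck_on n k U (partial_deriv i f)))"

definition smooth_on :: "nat \<Rightarrow> (nat \<Rightarrow> real) set \<Rightarrow> ((nat \<Rightarrow> real) \<Rightarrow> real) \<Rightarrow> bool" where
  "smooth_on n U f \<longleftrightarrow> (\<forall>k. Ck_on n k U f)"

definition smooth_into ::
  "nat \<Rightarrow> (nat \<Rightarrow> real) set \<Rightarrow> nat \<Rightarrow> (nat \<Rightarrow> real) set \<Rightarrow> ((nat \<Rightarrow> real) \<Rightarrow> nat \<Rightarrow> real) \<Rightarrow> bool" where
  "smooth_into m V n U h \<longleftrightarrow> h ` V \<subseteq> U \<and> (\<forall>i<n. smooth_on m V (\<lambda>w. h w i))"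

record 'a diffeological_space =
  points :: "'a set"
  plot :: "nat \<Rightarrow> (nat \<Rightarrow> real) set \<Rightarrow> ((nat \<Rightarrow> real) \<Rightarrow> 'a) \<Rightarrow> bool"

definition diffeology :: "'a diffeological_space \<Rightarrow> bool" where
  "diffeology X \<longleftrightarrow>
     (\<forall>n U p. plot X n U p \<longrightarrow> open_dom n U \<and> p ` U \<subseteq> points X) \<and>
     (\<forall>n U p p'. plot X n U p \<and> (\<forall>u\<in>U. p u = p' u) \<longrightarrow> plot X n U p') \<and>
     (\<forall>n U x. open_dom n U \<and> x \<in> points X \<longrightarrow> plot X n U (\<lambda>u. x)) \<and>
     (\<forall>n U p. open_dom n U \<and>
        (\<forall>u\<in>U. \<exists>V. u \<in> V \<and> V \<subseteq> U \<and> open_dom n V \<and> plot X n V p) \<longrightarrow> plot X n U p) \<and>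
     (\<forall>n U p m V h. plot X n U p \<and> open_dom m V \<and> smooth_into m V n U h \<longrightarrow>
        plot X m V (p \<circ> h))"

definition smooth_map ::
  "('a, 'c) diffeological_space_scheme \<Rightarrow> ('b, 'd) diffeological_space_scheme \<Rightarrow> ('a \<Rightarrow> 'b) \<Rightarrow> bool"
  where
  "smooth_map X Y f \<longleftrightarrow> f ` points X \<subseteq> points Y \<and>
     (\<forall>n U p. plot X n U p \<longrightarrow> plot Y n U (f \<circ> p))"

definition real_space :: "real diffeological_space" where
  "real_space = \<lparr>points = UNIV, plot = (\<lambda>n U p. open_dom n U \<and> smooth_on n U p)\<rparr>"

definition complex_space :: "complex diffeological_space" where
  "complex_space = \<lparr>points = UNIV, plot = (\<lambda>n U p. open_dom n U \<and>
     smooth_on n U (\<lambda>u. Re (p u)) \<and> smooth_on n U (\<lambda>u. Im (p u)))\<rparr>"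

definition subset_space :: "'a diffeological_space \<Rightarrow> 'a set \<Rightarrow> 'a diffeological_space" where
  "subset_space X S = \<lparr>points = points X \<inter> S, plot = (\<lambda>n U p. plot X n U p \<and> p ` U \<subseteq> S)\<rparr>"

definition prod_space ::
  "'a diffeological_space \<Rightarrow> 'b diffeological_space \<Rightarrow> ('a \<times> 'b) diffeological_space" where
  "prod_space X Y = \<lparr>points = points X \<times> points Y,
     plot = (\<lambda>n U p. plot X n U (fst \<circ> p) \<and> plot Y n U (snd \<circ> p))\<rparr>"

definition sequence_space :: "'a diffeological_space \<Rightarrow> (nat \<Rightarrow> 'a) diffeological_space" where
  "sequence_space X = \<lparr>points = {s. \<forall>i. s i \<in> points X},
     plot = (\<lambda>n U p. \<forall>i. plot X n U (\<lambda>u. p u i))\<rparr>"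

text \<open>Pushforward along \<open>f\<close>: plots are the parametrizations that lift locally through \<open>f\<close>.
  For a class map this is the quotient diffeology.\<close>

definition push_space :: "'a diffeological_space \<Rightarrow> ('a \<Rightarrow> 'b) \<Rightarrow> 'b diffeological_space" where
  "push_space X f = \<lparr>points = f ` points X,
     plot = (\<lambda>n U p. open_dom n U \<and>
       (\<forall>u\<in>U. \<exists>V p'. u \<in> V \<and> V \<subseteq> U \<and> plot X n V p' \<and> (\<forall>v\<in>V. p v = f (p' v))))\<rparr>"

definition map_space ::
  "'a diffeological_space \<Rightarrow> 'b diffeological_space \<Rightarrow> ('a \<Rightarrow> 'b) diffeological_space" where
  "map_space X Y = \<lparr>points = {f \<in> extensional (points X). smooth_map X Y f},
     plot = (\<lambda>n U P. open_dom n U \<and>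
       (\<forall>u\<in>U. P u \<in> extensional (points X) \<and> smooth_map X Y (P u)) \<and>
       (\<forall>m V h p. plot X m V p \<and> smooth_into m V n U h \<longrightarrow> plot Y m V (\<lambda>w. P (h w) (p w))))\<rparr>"

section \<open>Internal tangent and cotangent spaces\<close>

text \<open>Two smooth paths through \<open>x\<close> have the same velocity iff they differentiate every smooth
  real function in the same way. The class of a path is represented by the functional
  \<open>f \<mapsto> (f \<circ> c)'(0)\<close> on smooth functions (and zero on all other functions).\<close>

definition smooth_fun :: "'a diffeological_space \<Rightarrow> ('a \<Rightarrow> real) \<Rightarrow> bool" where
  "smooth_fun X f \<longleftrightarrow> smooth_map X real_space f"

definition velocity :: "'a diffeological_space \<Rightarrow> (real \<Rightarrow> 'a) \<Rightarrow> ('a \<Rightarrow> real) \<Rightarrow> real" where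
  "velocity X c = (\<lambda>f. if smooth_fun X f then deriv (f \<circ> c) 0 else 0)"

definition path_space :: "'a diffeological_space \<Rightarrow> 'a \<Rightarrow> (real \<Rightarrow> 'a) diffeological_space" where
  "path_space X x = subset_space (map_space real_space X) {c. c 0 = x}"

definition tangent_space ::
  "'a diffeological_space \<Rightarrow> 'a \<Rightarrow> (('a \<Rightarrow> real) \<Rightarrow> real) diffeological_space" where
  "tangent_space X x = push_space (path_space X x) (velocity X)"

definition differential ::
  "'a diffeological_space \<Rightarrow> ('a \<Rightarrow> real) \<Rightarrow> 'a \<Rightarrow> (('a \<Rightarrow> real) \<Rightarrow> real) \<Rightarrow> real" where
  "differential X f x = (\<lambda>v. if v \<in> points (tangent_space X x) then v f else 0)"

definition cotangent :: "'a diffeological_space \<Rightarrow> 'a \<Rightarrow> ((('a \<Rightarrow> real) \<Rightarrow> real) \<Rightarrow> real) set" where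
  "cotangent X x = {differential X f x | f. smooth_fun X f}"

section \<open>Lie algebras, morphisms and 2-cocycles\<close>

text \<open>All Lie algebras are real; a complex one enters through its underlying real one.\<close>

record 'a lie_structure =
  lie_carrier :: "'a set"
  lie_zero :: 'a
  lie_add :: "'a \<Rightarrow> 'a \<Rightarrow> 'a"
  lie_scale :: "real \<Rightarrow> 'a \<Rightarrow> 'a"
  lie_bracket :: "'a \<Rightarrow> 'a \<Rightarrow> 'a"

definition lie_algebra :: "'a lie_structure \<Rightarrow> bool" where
  "lie_algebra L \<longleftrightarrow>
     (let C = lie_carrier L; z = lie_zero L; a = lie_add L; s = lie_scale L; b = lie_bracket L in
       z \<in> C \<and> (\<forall>x\<in>C. \<forall>y\<in>C. a x y \<in> C \<and> b x y \<in> C) \<and> (\<forall>r. \<forall>x\<in>C. s r x \<in> C) \<and>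
       (\<forall>x\<in>C. \<forall>y\<in>C. a x y = a y x) \<and>
       (\<forall>x\<in>C. \<forall>y\<in>C. \<forall>w\<in>C. a (a x y) w = a x (a y w)) \<and>
       (\<forall>x\<in>C. a z x = x \<and> a x (s (-1) x) = z \<and> s 1 x = x) \<and>
       (\<forall>r t. \<forall>x\<in>C. s r (s t x) = s (r * t) x \<and> s (r + t) x = a (s r x) (s t x)) \<and>
       (\<forall>r. \<forall>x\<in>C. \<forall>y\<in>C. s r (a x y) = a (s r x) (s r y)) \<and>
       (\<forall>x\<in>C. \<forall>y\<in>C. \<forall>w\<in>C. b (a x y) w = a (b x w) (b y w) \<and> b w (a x y) = a (b w x) (b w y)) \<and>
       (\<forall>r. \<forall>x\<in>C. \<forall>y\<in>C. b (s r x) y = s r (b x y) \<and> b x (s r y) = s r (b x y)) \<and>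
       (\<forall>x\<in>C. b x x = z) \<and>
       (\<forall>x\<in>C. \<forall>y\<in>C. \<forall>w\<in>C. a (a (b (b x y) w) (b (b y w) x)) (b (b w x) y) = z))"

definition lie_morphism :: "'a lie_structure \<Rightarrow> 'b lie_structure \<Rightarrow> ('a \<Rightarrow> 'b) \<Rightarrow> bool" where
  "lie_morphism L M \<phi> \<longleftrightarrow>
     (\<forall>x\<in>lie_carrier L. \<phi> x \<in> lie_carrier M) \<and>
     (\<forall>x\<in>lie_carrier L. \<forall>y\<in>lie_carrier L.
        \<phi> (lie_add L x y) = lie_add M (\<phi> x) (\<phi> y) \<and>
        \<phi> (lie_bracket L x y) = lie_bracket M (\<phi> x) (\<phi> y)) \<and>
     (\<forall>r. \<forall>x\<in>lie_carrier L. \<phi> (lie_scale L r x) = lie_scale M r (\<phi> x))"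

definition lie_2_cocycle :: "'a lie_structure \<Rightarrow> ('a \<Rightarrow> 'a \<Rightarrow> complex) \<Rightarrow> bool" where
  "lie_2_cocycle L c \<longleftrightarrow>
     (\<forall>x\<in>lie_carrier L. \<forall>y\<in>lie_carrier L. c x y = - c y x) \<and>
     (\<forall>x\<in>lie_carrier L. \<forall>y\<in>lie_carrier L. \<forall>w\<in>lie_carrier L.
        c (lie_add L x y) w = c x w + c y w \<and> c w (lie_add L x y) = c w x + c w y) \<and>
     (\<forall>r. \<forall>x\<in>lie_carrier L. \<forall>y\<in>lie_carrier L.
        c (lie_scale L r x) y = of_real r * c x y \<and> c x (lie_scale L r y) = of_real r * c x y) \<and>
     (\<forall>x\<in>lie_carrier L. \<forall>y\<in>lie_carrier L. \<forall>w\<in>lie_carrier L.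
        c (lie_bracket L x y) w + c (lie_bracket L y w) x + c (lie_bracket L w x) y = 0)"

section \<open>Regular diffeological Lie groups\<close>

definition diffeological_group :: "'g monoid \<Rightarrow> 'g diffeological_space \<Rightarrow> bool" where
  "diffeological_group G X \<longleftrightarrow> group G \<and> diffeology X \<and> points X = carrier G \<and>
     smooth_map (prod_space X X) X (\<lambda>(g, h). g \<otimes>\<^bsub>G\<^esub> h) \<and> smooth_map X X (\<lambda>g. inv\<^bsub>G\<^esub> g)"

text \<open>The internal tangent space at the unit. The bracket is the derivative of the adjoint action:
  if \<open>\<xi>\<close>, \<open>\<eta>\<close> are the velocities of \<open>c\<close>, \<open>d\<close>, then \<open>[\<xi>,\<eta>]\<close> sends \<open>f\<close> to
  \<open>\<partial>\<^sub>t \<partial>\<^sub>s f (c(t) d(s) c(t)\<^sup>-\<^sup>1)\<close> at \<open>t = s = 0\<close>. The sum is the velocity of \<open>t \<mapsto> c(t) d(t)\<close>.\<close>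

definition lie_of :: "'g monoid \<Rightarrow> 'g diffeological_space \<Rightarrow> (('g \<Rightarrow> real) \<Rightarrow> real) lie_structure" where
  "lie_of G X = \<lparr>
     lie_carrier = points (tangent_space X \<one>\<^bsub>G\<^esub>),
     lie_zero = (\<lambda>f. 0),
     lie_add = (\<lambda>\<xi> \<eta> f. \<xi> f + \<eta> f),
     lie_scale = (\<lambda>r \<xi> f. r * \<xi> f),
     lie_bracket = (\<lambda>\<xi> \<eta> f. if smooth_fun X f
        then \<xi> (\<lambda>g. \<eta> (\<lambda>h. f (g \<otimes>\<^bsub>G\<^esub> h \<otimes>\<^bsub>G\<^esub> inv\<^bsub>G\<^esub> g))) else 0)\<rparr>"

definition diffeological_lie_group :: "'g monoid \<Rightarrow> 'g diffeological_space \<Rightarrow> bool" where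
  "diffeological_lie_group G X \<longleftrightarrow> diffeological_group G X \<and> lie_algebra (lie_of G X)"

text \<open>\<open>\<gamma>'(t) \<gamma>(t)\<^sup>-\<^sup>1 = v(t)\<close> on the unit interval.\<close>

definition right_log_deriv ::
  "'g monoid \<Rightarrow> 'g diffeological_space \<Rightarrow> (real \<Rightarrow> 'g) \<Rightarrow> (real \<Rightarrow> ('g \<Rightarrow> real) \<Rightarrow> real) \<Rightarrow> bool" where
  "right_log_deriv G X \<gamma> v \<longleftrightarrow> (\<forall>t\<in>{0..1}. \<forall>f. smooth_fun X f \<longrightarrow>
     ((\<lambda>s. f (\<gamma> s \<otimes>\<^bsub>G\<^esub> inv\<^bsub>G\<^esub> (\<gamma> t))) has_real_derivative v t f) (at t within {0..1}))"

definition regular_diffeological_lie_group :: "'g monoid \<Rightarrow> 'g diffeological_space \<Rightarrow> bool" where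
  "regular_diffeological_lie_group G X \<longleftrightarrow> diffeological_lie_group G X \<and>
     (let I = subset_space real_space {0..1};
          Pg = map_space I (tangent_space X \<one>\<^bsub>G\<^esub>); PG = map_space I X
      in \<exists>Ex. smooth_map Pg PG Ex \<and>
           (\<forall>v\<in>points Pg. \<forall>\<gamma>\<in>points PG.
              \<gamma> 0 = \<one>\<^bsub>G\<^esub> \<and> right_log_deriv G X \<gamma> v \<longleftrightarrow> \<gamma> = Ex v))"

section \<open>The spherical Milnor space\<close>

definition pre_sphere :: "'g monoid \<Rightarrow> (nat \<Rightarrow> real \<times> 'g) set" where
  "pre_sphere G = {p. (\<forall>i. snd (p i) \<in> carrier G) \<and> finite {i. fst (p i) \<noteq> 0} \<and>
     (\<Sum>i | fst (p i) \<noteq> 0. (fst (p i))\<^sup>2) = 1}"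

definition sphere_rel :: "'g monoid \<Rightarrow> ((nat \<Rightarrow> real \<times> 'g) \<times> (nat \<Rightarrow> real \<times> 'g)) set" where
  "sphere_rel G = {(p, q). p \<in> pre_sphere G \<and> q \<in> pre_sphere G \<and>
     (\<forall>i. fst (p i) = fst (q i) \<and> (fst (p i) \<noteq> 0 \<longrightarrow> snd (p i) = snd (q i)))}"

definition milnor_sphere ::
  "'g monoid \<Rightarrow> 'g diffeological_space \<Rightarrow> (nat \<Rightarrow> real \<times> 'g) set diffeological_space" where
  "milnor_sphere G X = push_space
     (subset_space (sequence_space (prod_space real_space X)) (pre_sphere G))
     (\<lambda>p. sphere_rel G `` {p})"

definition milnor_act ::
  "'g monoid \<Rightarrow> 'g \<Rightarrow> (nat \<Rightarrow> real \<times> 'g) set \<Rightarrow> (nat \<Rightarrow> real \<times> 'g) set" where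
  "milnor_act G h z = (\<lambda>p i. (fst (p i), h \<otimes>\<^bsub>G\<^esub> snd (p i))) ` z"

text \<open>\<open>\<xi>\<^sup>#\<close> at \<open>x\<close> is the velocity of \<open>t \<mapsto> c(t) \<cdot> x\<close> for any path \<open>c\<close> with velocity \<open>\<xi>\<close>.\<close>

definition fundamental_field ::
  "'g monoid \<Rightarrow> 'g diffeological_space \<Rightarrow> (('g \<Rightarrow> real) \<Rightarrow> real) \<Rightarrow> (nat \<Rightarrow> real \<times> 'g) set \<Rightarrow>
   ((nat \<Rightarrow> real \<times> 'g) set \<Rightarrow> real) \<Rightarrow> real" where
  "fundamental_field G X \<xi> x =
     (\<lambda>f. if smooth_fun (milnor_sphere G X) f then \<xi> (\<lambda>h. f (milnor_act G h x)) else 0)"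

section \<open>Clifford modules, Dirac-type operators and Lie derivatives\<close>

text \<open>The fibres \<open>F x\<close> are complex subspaces of one ambient complex vector space \<open>'v\<close> (no topology
  is used on it); any family of vector spaces embeds fibrewise into such a space. The total space
  carries its own diffeology \<open>E\<close>. No local triviality is required.\<close>

definition vector_bundle ::
  "'x diffeological_space \<Rightarrow> (complex \<Rightarrow> 'v::ab_group_add \<Rightarrow> 'v) \<Rightarrow> ('x \<Rightarrow> 'v set) \<Rightarrow>
   ('x \<times> 'v) diffeological_space \<Rightarrow> bool" where
  "vector_bundle X scl F E \<longleftrightarrow>
     vector_space scl \<and> (\<forall>x\<in>points X. module.subspace scl (F x)) \<and>
     diffeology E \<and> points E = Sigma (points X) F \<and>
     smooth_map E X fst \<and> smooth_map X E (\<lambda>x. (x, 0)) \<and>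
     (\<forall>n U p q. plot E n U p \<and> plot E n U q \<and> (\<forall>u\<in>U. fst (p u) = fst (q u)) \<longrightarrow>
        plot E n U (\<lambda>u. (fst (p u), snd (p u) + snd (q u)))) \<and>
     (\<forall>n U p z. plot E n U p \<and> plot complex_space n U z \<longrightarrow>
        plot E n U (\<lambda>u. (fst (p u), scl (z u) (snd (p u)))))"

text \<open>Sections are normalized to vanish outside the base.\<close>

definition sections ::
  "'x diffeological_space \<Rightarrow> ('x \<times> 'v::ab_group_add) diffeological_space \<Rightarrow> ('x \<Rightarrow> 'v) set" where
  "sections X E = {s. smooth_map X E (\<lambda>x. (x, s x)) \<and> (\<forall>x. x \<notin> points X \<longrightarrow> s x = 0)}"

text \<open>\<open>q\<close> is a smooth pseudo-metric on cotangent vectors and \<open>c\<close> the Clifford multiplication,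
  with the convention \<open>c(\<alpha>)\<^sup>2 = - q(\<alpha>,\<alpha>)\<close>.\<close>

definition clifford_module ::
  "'x diffeological_space \<Rightarrow> (complex \<Rightarrow> 'v::ab_group_add \<Rightarrow> 'v) \<Rightarrow> ('x \<Rightarrow> 'v set) \<Rightarrow>
   ('x \<times> 'v) diffeological_space \<Rightarrow>
   ('x \<Rightarrow> ((('x \<Rightarrow> real) \<Rightarrow> real) \<Rightarrow> real) \<Rightarrow> ((('x \<Rightarrow> real) \<Rightarrow> real) \<Rightarrow> real) \<Rightarrow> real) \<Rightarrow>
   ('x \<Rightarrow> ((('x \<Rightarrow> real) \<Rightarrow> real) \<Rightarrow> real) \<Rightarrow> 'v \<Rightarrow> 'v) \<Rightarrow> bool" where
  "clifford_module X scl F E q c \<longleftrightarrow>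
     vector_bundle X scl F E \<and>
     (\<forall>x\<in>points X.
       (\<forall>\<alpha>\<in>cotangent X x. \<forall>\<beta>\<in>cotangent X x. \<forall>\<gamma>\<in>cotangent X x. \<forall>r.
          q x \<alpha> \<beta> = q x \<beta> \<alpha> \<and> q x \<alpha> \<alpha> \<ge> 0 \<and>
          q x (\<lambda>v. r * \<alpha> v + \<beta> v) \<gamma> = r * q x \<alpha> \<gamma> + q x \<beta> \<gamma>) \<and>
       (\<forall>\<alpha>\<in>cotangent X x. \<forall>e\<in>F x. \<forall>e'\<in>F x. \<forall>z.
          c x \<alpha> e \<in> F x \<and> c x \<alpha> (scl z e + e') = scl z (c x \<alpha> e) + c x \<alpha> e') \<and>
       (\<forall>\<alpha>\<in>cotangent X x. \<forall>\<beta>\<in>cotangent X x. \<forall>e\<in>F x. \<forall>r.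
          c x (\<lambda>v. r * \<alpha> v + \<beta> v) e = scl (of_real r) (c x \<alpha> e) + c x \<beta> e) \<and>
       (\<forall>\<alpha>\<in>cotangent X x. \<forall>e\<in>F x. c x \<alpha> (c x \<alpha> e) = scl (of_real (- q x \<alpha> \<alpha>)) e)) \<and>
     (\<forall>f g. smooth_fun X f \<and> smooth_fun X g \<longrightarrow>
        smooth_fun X (\<lambda>x. q x (differential X f x) (differential X g x))) \<and>
     (\<forall>f. \<forall>s\<in>sections X E. smooth_fun X f \<longrightarrow>
        (\<lambda>x. if x \<in> points X then c x (differential X f x) (s x) else 0) \<in> sections X E)"

definition section_operator ::
  "'x diffeological_space \<Rightarrow> (complex \<Rightarrow> 'v::ab_group_add \<Rightarrow> 'v) \<Rightarrow> ('x \<times> 'v) diffeological_space \<Rightarrow>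
   (('x \<Rightarrow> 'v) \<Rightarrow> 'x \<Rightarrow> 'v) \<Rightarrow> bool" where
  "section_operator X scl E A \<longleftrightarrow>
     (\<forall>s\<in>sections X E. A s \<in> sections X E) \<and>
     (\<forall>s\<in>sections X E. \<forall>t\<in>sections X E. \<forall>z.
        A (\<lambda>x. scl z (s x) + t x) = (\<lambda>x. scl z (A s x) + A t x))"

text \<open>The principal symbol of \<open>D\<close> is Clifford multiplication: \<open>[D, f] = c(df)\<close>.\<close>

definition dirac_type ::
  "'x diffeological_space \<Rightarrow> (complex \<Rightarrow> 'v::ab_group_add \<Rightarrow> 'v) \<Rightarrow> ('x \<times> 'v) diffeological_space \<Rightarrow>
   ('x \<Rightarrow> ((('x \<Rightarrow> real) \<Rightarrow> real) \<Rightarrow> real) \<Rightarrow> 'v \<Rightarrow> 'v) \<Rightarrow> (('x \<Rightarrow> 'v) \<Rightarrow> 'x \<Rightarrow> 'v) \<Rightarrow> bool" where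
  "dirac_type X scl E c D \<longleftrightarrow> section_operator X scl E D \<and>
     (\<forall>f. \<forall>s\<in>sections X E. \<forall>x\<in>points X. smooth_fun X f \<longrightarrow>
        D (\<lambda>y. scl (of_real (f y)) (s y)) x =
          scl (of_real (f x)) (D s x) + c x (differential X f x) (s x))"

text \<open>The existence of Lie derivatives of sections along fundamental fields is part of the data:
  \<open>L \<xi>\<close> is a derivation of the module of sections over the vector field \<open>\<xi>\<^sup>#\<close>, real-linear in \<open>\<xi>\<close>.
  This leaves open how the flow of \<open>\<xi>\<^sup>#\<close> is lifted to the bundle.\<close>

definition lie_derivatives ::
  "'g monoid \<Rightarrow> 'g diffeological_space \<Rightarrow> (complex \<Rightarrow> 'v::ab_group_add \<Rightarrow> 'v) \<Rightarrow>
   ((nat \<Rightarrow> real \<times> 'g) set \<times> 'v) diffeological_space \<Rightarrow>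
   ((('g \<Rightarrow> real) \<Rightarrow> real) \<Rightarrow> ((nat \<Rightarrow> real \<times> 'g) set \<Rightarrow> 'v) \<Rightarrow> (nat \<Rightarrow> real \<times> 'g) set \<Rightarrow> 'v) \<Rightarrow> bool"
  where
  "lie_derivatives G X scl E L \<longleftrightarrow>
     (let M = milnor_sphere G X; \<gg> = lie_of G X in
       (\<forall>\<xi>\<in>lie_carrier \<gg>. section_operator M scl E (L \<xi>) \<and>
          (\<forall>f. \<forall>s\<in>sections M E. \<forall>x\<in>points M. smooth_fun M f \<longrightarrow>
             L \<xi> (\<lambda>y. scl (of_real (f y)) (s y)) x =
               scl (of_real (fundamental_field G X \<xi> x f)) (s x) + scl (of_real (f x)) (L \<xi> s x))) \<and>
       (\<forall>\<xi>\<in>lie_carrier \<gg>. \<forall>\<eta>\<in>lie_carrier \<gg>. \<forall>r. \<forall>s\<in>sections M E.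
          L (lie_add \<gg> (lie_scale \<gg> r \<xi>) \<eta>) s = (\<lambda>x. scl (of_real r) (L \<xi> s x) + L \<eta> s x)))"

section \<open>Polarized Hilbert spaces and the Schwinger cocycle\<close>

text \<open>The inner product is antilinear in its first argument.\<close>

class complex_hilbert = real_inner + complete_space +
  fixes scaleC :: "complex \<Rightarrow> 'a \<Rightarrow> 'a"
    and cinner :: "'a \<Rightarrow> 'a \<Rightarrow> complex"
  assumes scaleC_of_real: "scaleC (complex_of_real r) x = scaleR r x"
    and scaleC_scaleC: "scaleC z (scaleC w x) = scaleC (z * w) x"
    and scaleC_add_left: "scaleC (z + w) x = scaleC z x + scaleC w x"
    and scaleC_add_right: "scaleC z (x + y) = scaleC z x + scaleC z y"
    and cinner_commute: "cinner x y = cnj (cinner y x)"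
    and cinner_add_right: "cinner x (y + y') = cinner x y + cinner x y'"
    and cinner_scaleC_right: "cinner x (scaleC z y) = z * cinner x y"
    and Re_cinner: "Re (cinner x y) = x \<bullet> y"

definition closed_csubspace :: "'h::complex_hilbert set \<Rightarrow> bool" where
  "closed_csubspace S \<longleftrightarrow> closed S \<and> 0 \<in> S \<and> (\<forall>x\<in>S. \<forall>y\<in>S. x + y \<in> S) \<and> (\<forall>z. \<forall>x\<in>S. scaleC z x \<in> S)"

definition polarization :: "'h::complex_hilbert set \<Rightarrow> 'h set \<Rightarrow> bool" where
  "polarization Hp Hm \<longleftrightarrow> closed_csubspace Hp \<and> closed_csubspace Hm \<and>
     (\<forall>x\<in>Hp. \<forall>y\<in>Hm. cinner x y = 0) \<and> (\<forall>x. \<exists>u\<in>Hp. \<exists>v\<in>Hm. x = u + v)"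

definition oproj :: "'h::complex_hilbert set \<Rightarrow> 'h \<Rightarrow> 'h" where
  "oproj S x = (THE u. u \<in> S \<and> (\<forall>w\<in>S. cinner w (x - u) = 0))"

text \<open>The block of \<open>A\<close> from \<open>R\<close> to \<open>S\<close>, extended by zero on the complement of \<open>R\<close>. Thus
  \<open>A\<^sub>-\<^sub>+ : H\<^sub>+ \<rightarrow> H\<^sub>-\<close> is \<open>block Hm Hp A\<close>.\<close>

definition block :: "'h::complex_hilbert set \<Rightarrow> 'h set \<Rightarrow> ('h \<Rightarrow>\<^sub>L 'h) \<Rightarrow> 'h \<Rightarrow> 'h" where
  "block S R A x = oproj S (blinfun_apply A (oproj R x))"

definition onb_of :: "'h::complex_hilbert set \<Rightarrow> 'h set \<Rightarrow> bool" where
  "onb_of S B \<longleftrightarrow> B \<subseteq> S \<and> (\<forall>e\<in>B. \<forall>f\<in>B. cinner e f = (if e = f then 1 else 0)) \<and>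
     (\<forall>x\<in>S. (\<forall>e\<in>B. cinner e x = 0) \<longrightarrow> x = 0)"

definition hilbert_schmidt_on :: "'h::complex_hilbert set \<Rightarrow> ('h \<Rightarrow> 'h) \<Rightarrow> bool" where
  "hilbert_schmidt_on S T \<longleftrightarrow> (\<exists>B. onb_of S B \<and> (\<lambda>e. (norm (T e))\<^sup>2) summable_on B)"

text \<open>For trace class operators on \<open>S\<close> the value does not depend on the orthonormal basis.\<close>

definition trace_on :: "'h::complex_hilbert set \<Rightarrow> ('h \<Rightarrow> 'h) \<Rightarrow> complex" where
  "trace_on S T = infsum (\<lambda>e. cinner e (T e)) (SOME B. onb_of S B)"

definition complex_linear_op :: "('h::complex_hilbert \<Rightarrow>\<^sub>L 'h) \<Rightarrow> bool" where
  "complex_linear_op A \<longleftrightarrow> (\<forall>z x. blinfun_apply A (scaleC z x) = scaleC z (blinfun_apply A x))"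

definition gl_res :: "'h::complex_hilbert set \<Rightarrow> 'h set \<Rightarrow> ('h \<Rightarrow>\<^sub>L 'h) lie_structure" where
  "gl_res Hp Hm = \<lparr>
     lie_carrier = {A. complex_linear_op A \<and>
        hilbert_schmidt_on Hm (block Hp Hm A) \<and> hilbert_schmidt_on Hp (block Hm Hp A)},
     lie_zero = 0, lie_add = (+), lie_scale = (*\<^sub>R),
     lie_bracket = (\<lambda>A B. (A o\<^sub>L B) - (B o\<^sub>L A))\<rparr>"

definition schwinger_cocycle ::
  "'h::complex_hilbert set \<Rightarrow> 'h set \<Rightarrow> ('h \<Rightarrow>\<^sub>L 'h) \<Rightarrow> ('h \<Rightarrow>\<^sub>L 'h) \<Rightarrow> complex" where
  "schwinger_cocycle Hp Hm A B = trace_on Hm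
     (\<lambda>x. block Hm Hp A (block Hp Hm B x) - block Hm Hp B (block Hp Hm A x))"

section \<open>The equivariance defect on the Hilbert module\<close>

text \<open>\<open>H\<close> is a Hilbert space into which a complex subspace \<open>\<Gamma>\<close> of the smooth sections is mapped
  linearly and with dense range (e.g. the square integrable ones). An operator on sections
  defines a bounded operator on \<open>H\<close> if it preserves \<open>\<Gamma>\<close> and extends continuously; the extension
  is unique by density.\<close>

definition hilbert_module ::
  "'x diffeological_space \<Rightarrow> (complex \<Rightarrow> 'v::ab_group_add \<Rightarrow> 'v) \<Rightarrow> ('x \<times> 'v) diffeological_space \<Rightarrow>
   ('x \<Rightarrow> 'v) set \<Rightarrow> (('x \<Rightarrow> 'v) \<Rightarrow> 'h::complex_hilbert) \<Rightarrow> bool" where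
  "hilbert_module X scl E \<Gamma> \<iota> \<longleftrightarrow>
     \<Gamma> \<subseteq> sections X E \<and> (\<lambda>x. 0) \<in> \<Gamma> \<and>
     (\<forall>s\<in>\<Gamma>. \<forall>t\<in>\<Gamma>. \<forall>z. (\<lambda>x. scl z (s x) + t x) \<in> \<Gamma> \<and>
        \<iota> (\<lambda>x. scl z (s x) + t x) = scaleC z (\<iota> s) + \<iota> t) \<and>
     closure (\<iota> ` \<Gamma>) = UNIV"

definition extends_to ::
  "('x \<Rightarrow> 'v) set \<Rightarrow> (('x \<Rightarrow> 'v) \<Rightarrow> 'h::complex_hilbert) \<Rightarrow> (('x \<Rightarrow> 'v) \<Rightarrow> 'x \<Rightarrow> 'v) \<Rightarrow> ('h \<Rightarrow>\<^sub>L 'h) \<Rightarrow> bool"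
  where
  "extends_to \<Gamma> \<iota> A T \<longleftrightarrow> (\<forall>s\<in>\<Gamma>. A s \<in> \<Gamma> \<and> blinfun_apply T (\<iota> s) = \<iota> (A s))"

definition op_commutator ::
  "(('x \<Rightarrow> 'v::ab_group_add) \<Rightarrow> 'x \<Rightarrow> 'v) \<Rightarrow> (('x \<Rightarrow> 'v) \<Rightarrow> 'x \<Rightarrow> 'v) \<Rightarrow> ('x \<Rightarrow> 'v) \<Rightarrow> 'x \<Rightarrow> 'v" where
  "op_commutator A B s = (\<lambda>x. A (B s) x - B (A s) x)"

definition defect ::
  "('x \<Rightarrow> 'v::ab_group_add) set \<Rightarrow> (('x \<Rightarrow> 'v) \<Rightarrow> 'h::complex_hilbert) \<Rightarrow>
   ('l \<Rightarrow> ('x \<Rightarrow> 'v) \<Rightarrow> 'x \<Rightarrow> 'v) \<Rightarrow> (('x \<Rightarrow> 'v) \<Rightarrow> 'x \<Rightarrow> 'v) \<Rightarrow> 'l \<Rightarrow> 'h \<Rightarrow>\<^sub>L 'h" where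
  "defect \<Gamma> \<iota> L D \<xi> = (THE T. extends_to \<Gamma> \<iota> (op_commutator (L \<xi>) D) T)"

definition defect_cocycle ::
  "'h::complex_hilbert set \<Rightarrow> 'h set \<Rightarrow> ('x \<Rightarrow> 'v::ab_group_add) set \<Rightarrow> (('x \<Rightarrow> 'v) \<Rightarrow> 'h) \<Rightarrow>
   ('l \<Rightarrow> ('x \<Rightarrow> 'v) \<Rightarrow> 'x \<Rightarrow> 'v) \<Rightarrow> (('x \<Rightarrow> 'v) \<Rightarrow> 'x \<Rightarrow> 'v) \<Rightarrow> 'l \<Rightarrow> 'l \<Rightarrow> complex" where
  "defect_cocycle Hp Hm \<Gamma> \<iota> L D \<xi> \<eta> =
     schwinger_cocycle Hp Hm (defect \<Gamma> \<iota> L D \<xi>) (defect \<Gamma> \<iota> L D \<eta>)"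

end

theory Submission
  imports Defs
begin

text \<open>
  The morphism hypothesis reduces the claim to one about the Lie algebra
  \<open>\<gg>\<ll>\<^sub>r\<^sub>e\<^sub>s\<close> itself: a 2-cocycle pulls back along any Lie algebra morphism
  (\<open>lie_2_cocycle_pullback\<close>), and the Schwinger functional is a 2-cocycle on \<open>\<gg>\<ll>\<^sub>r\<^sub>e\<^sub>s\<close>
  (\<open>lie_2_cocycle_schwinger\<close>). All the analysis lies in the second statement.

  Write an operator as a block matrix with diagonal blocks \<open>A\<^sub>+\<^sub>+\<close>, \<open>A\<^sub>-\<^sub>-\<close> and
  Hilbert--Schmidt off-diagonal blocks \<open>A\<^sub>+\<^sub>-\<close>, \<open>A\<^sub>-\<^sub>+\<close>. In
  \<open>Tr([A,B]\<^sub>-\<^sub>+ C\<^sub>+\<^sub>- - C\<^sub>-\<^sub>+ [A,B]\<^sub>+\<^sub>-)\<close> each of the eight terms is the trace of a product of two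
  off-diagonal blocks and one diagonal block. In the terms where the diagonal block is
  \<open>X\<^sub>+\<^sub>+\<close>, it stands in the middle, and the terms cancel in the cyclic sum over \<open>A\<close>, \<open>B\<close>, \<open>C\<close>
  word by word. In the others, \<open>X\<^sub>-\<^sub>-\<close> stands at the left or at the right end; once it has been
  moved to the right end by \<open>Tr(X\<^sub>-\<^sub>- U T) = Tr(U T X\<^sub>-\<^sub>-)\<close> (\<open>pairing_move\<close>), these cancel as well.

  The trace identity needed here is an instance of \<open>Tr(U T) = Tr(T U)\<close> for Hilbert--Schmidt maps
  \<open>T : S \<rightarrow> R\<close> and \<open>U : R \<rightarrow> S\<close> (\<open>trace_cyclic\<close>): both sides sum the absolutely summable family
  \<open>\<langle>e, U f\<rangle> \<langle>f, T e\<rangle>\<close> over orthonormal bases of \<open>S\<close> and \<open>R\<close>, in different orders. It is used twice,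
  for the Hilbert--Schmidt pairs \<open>(T, X\<^sub>-\<^sub>- U)\<close> and \<open>(T X\<^sub>-\<^sub>-, U)\<close>.

  Since the Hilbert--Schmidt condition refers to some orthonormal basis and the trace to a chosen
  one, the basis independence of square summability is needed. It follows from
  \<open>\<Sum>\<^sub>e \<parallel>T e\<parallel>\<^sup>2 = \<Sum>\<^sub>f \<parallel>T\<^sup>* f\<parallel>\<^sup>2\<close>, whose right side does not mention the basis of the domain
  (\<open>square_summable_iff_adjoint\<close>). The same formula shows that \<open>T D\<close> is Hilbert--Schmidt for
  bounded \<open>D\<close>. The required Hilbert space theory (bases, Parseval, Riesz) is derived from the
  class axioms.
\<close>

section \<open>Complex inner product spaces\<close>

lemma cinner_add_left: "cinner (x + y) z = cinner x z + cinner y (z::'h::complex_hilbert)"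
  by (metis cinner_commute cinner_add_right complex_cnj_add)

lemma cinner_scaleC_left: "cinner (scaleC a x) y = cnj a * cinner x (y::'h::complex_hilbert)"
  by (metis cinner_commute cinner_scaleC_right complex_cnj_mult)

lemma cinner_scaleR_right: "cinner x (r *\<^sub>R y) = of_real r * cinner x (y::'h::complex_hilbert)"
  by (metis scaleC_of_real cinner_scaleC_right)

lemma cinner_diff_right: "cinner x (y - z) = cinner x y - cinner x (z::'h::complex_hilbert)"
  using cinner_add_right[of x "y - z" z] by simp

lemma cinner_diff_left: "cinner (x - y) z = cinner x z - cinner y (z::'h::complex_hilbert)"
  using cinner_add_left[of "x - y" y z] by simp

lemma cinner_zero_right [simp]: "cinner x (0::'h::complex_hilbert) = 0"
  using cinner_diff_right[of x 0 0] by simp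

lemma cinner_zero_left [simp]: "cinner (0::'h::complex_hilbert) x = 0"
  using cinner_diff_left[of 0 0 x] by simp

lemma cinner_sum_right: "cinner x (\<Sum>i\<in>I. f i) = (\<Sum>i\<in>I. cinner x (f i :: 'h::complex_hilbert))"
  by (induction I rule: infinite_finite_induct) (auto simp: cinner_add_right)

lemma cinner_sum_left: "cinner (\<Sum>i\<in>I. f i) x = (\<Sum>i\<in>I. cinner (f i) (x :: 'h::complex_hilbert))"
  by (induction I rule: infinite_finite_induct) (auto simp: cinner_add_left)

lemma cinner_self: "cinner x (x::'h::complex_hilbert) = of_real ((norm x)\<^sup>2)"
proof -
  have "Im (cinner x x) = 0"
    using arg_cong[OF cinner_commute[of x x], of Im] by simp
  moreover have "Re (cinner x x) = (norm x)\<^sup>2"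
    by (simp add: Re_cinner power2_norm_eq_inner)
  ultimately show ?thesis by (simp add: complex_eq_iff)
qed

lemma cnj_mult_self: "cnj z * z = of_real ((cmod z)\<^sup>2)"
  by (simp only: complex_norm_square mult.commute)

lemma norm_scaleC: "norm (scaleC a (x::'h::complex_hilbert)) = cmod a * norm x"
proof -
  have "complex_of_real ((norm (scaleC a x))\<^sup>2) = a * cnj a * of_real ((norm x)\<^sup>2)"
    using cinner_self[of "scaleC a x"] cinner_self[of x]
    by (simp add: cinner_scaleC_left cinner_scaleC_right mult.assoc)
  also have "\<dots> = of_real ((cmod a * norm x)\<^sup>2)"
    by (simp only: power_mult_distrib of_real_mult complex_norm_square)
  finally have "(norm (scaleC a x))\<^sup>2 = (cmod a * norm x)\<^sup>2"
    using of_real_eq_iff by blast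
  then show ?thesis by (simp add: power2_eq_iff_nonneg)
qed

text \<open>The real Cauchy--Schwarz inequality controls only the real part; a rotation of \<open>y\<close> by a unit
  scalar makes the complex inner product real.\<close>

lemma Cauchy_Schwarz_cinner: "cmod (cinner x y) \<le> norm x * norm (y::'h::complex_hilbert)"
proof (cases "cinner x y = 0")
  case False
  define a where "a = cnj (cinner x y) / of_real (cmod (cinner x y))"
  have a: "cmod a = 1" using False by (simp add: a_def norm_divide)
  have "a * cinner x y = cinner x y * cnj (cinner x y) / of_real (cmod (cinner x y))"
    by (simp add: a_def)
  also have "\<dots> = of_real ((cmod (cinner x y))\<^sup>2) / of_real (cmod (cinner x y))"
    by (simp only: complex_norm_square)
  also have "\<dots> = of_real (cmod (cinner x y))"
    using False by (simp add: power2_eq_square)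
  finally have "a * cinner x y = of_real (cmod (cinner x y))" .
  then have "cmod (cinner x y) = Re (cinner x (scaleC a y))"
    by (simp add: cinner_scaleC_right)
  also have "\<dots> = inner x (scaleC a y)" by (rule Re_cinner)
  also have "\<dots> \<le> norm x * norm (scaleC a y)" by (rule norm_cauchy_schwarz)
  finally show ?thesis by (simp add: norm_scaleC a)
qed auto

lemma bounded_linear_cinner_right: "bounded_linear (cinner (x::'h::complex_hilbert))"
  by (rule bounded_linear_intro[where K = "norm x"])
     (use Cauchy_Schwarz_cinner[of x] in
       \<open>auto simp: cinner_add_right cinner_scaleR_right scaleR_conv_of_real mult.commute\<close>)

lemma norm_add_orthogonal:
  assumes "cinner x (y::'h::complex_hilbert) = 0"
  shows "(norm (x + y))\<^sup>2 = (norm x)\<^sup>2 + (norm y)\<^sup>2"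
proof -
  have "inner x y = 0" using assms by (simp flip: Re_cinner)
  then show ?thesis by (simp add: power2_norm_eq_inner inner_add inner_commute)
qed

section \<open>Orthonormal bases, Parseval and Riesz\<close>

definition orthonormal :: "'h::complex_hilbert set \<Rightarrow> bool" where
  "orthonormal B \<longleftrightarrow> (\<forall>e\<in>B. \<forall>f\<in>B. cinner e f = (if e = f then 1 else 0))"

lemma orthonormalD:
  "orthonormal B \<Longrightarrow> e \<in> B \<Longrightarrow> f \<in> B \<Longrightarrow> cinner e f = (if e = f then 1 else 0)"
  by (simp add: orthonormal_def)

lemma orthonormal_subset: "orthonormal B \<Longrightarrow> F \<subseteq> B \<Longrightarrow> orthonormal F"
  by (simp add: orthonormal_def subset_iff)

lemma norm_sum_orthonormal:
  assumes "finite F" and on: "orthonormal F"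
  shows "(norm (\<Sum>e\<in>F. scaleC (a e) e))\<^sup>2 = (\<Sum>e\<in>F. (cmod (a e))\<^sup>2)"
proof -
  have "cinner (\<Sum>e\<in>F. scaleC (a e) e) (\<Sum>e\<in>F. scaleC (a e) e)
      = (\<Sum>e\<in>F. \<Sum>f\<in>F. cnj (a e) * (a f * cinner e f))"
    unfolding cinner_sum_left unfolding cinner_sum_right
    by (simp add: cinner_scaleC_left cinner_scaleC_right mult_ac)
  also have "\<dots> = (\<Sum>e\<in>F. cnj (a e) * a e)"
  proof (rule sum.cong)
    fix e assume e: "e \<in> F"
    have "(\<Sum>f\<in>F. cnj (a e) * (a f * cinner e f)) = (\<Sum>f\<in>F. if f = e then cnj (a e) * a e else 0)"
      by (rule sum.cong) (use e in \<open>auto simp: orthonormalD[OF on]\<close>)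
    also have "\<dots> = cnj (a e) * a e" using e assms(1) by simp
    finally show "(\<Sum>f\<in>F. cnj (a e) * (a f * cinner e f)) = cnj (a e) * a e" .
  qed simp
  also have "\<dots> = of_real (\<Sum>e\<in>F. (cmod (a e))\<^sup>2)"
    by (simp only: of_real_sum cnj_mult_self)
  finally show ?thesis unfolding cinner_self by (simp only: of_real_eq_iff)
qed

lemma onb_ofD:
  assumes "onb_of S B"
  shows "B \<subseteq> S" "orthonormal B"
    "x \<in> S \<Longrightarrow> (\<And>e. e \<in> B \<Longrightarrow> cinner e x = 0) \<Longrightarrow> x = 0"
  using assms by (simp_all add: onb_of_def orthonormal_def)

lemma closed_csubspaceD:
  assumes "closed_csubspace S"
  shows "closed S" "0 \<in> S" "x \<in> S \<Longrightarrow> y \<in> S \<Longrightarrow> x + y \<in> S" "x \<in> S \<Longrightarrow> scaleC z x \<in> S"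
    "x \<in> S \<Longrightarrow> r *\<^sub>R x \<in> S" "x \<in> S \<Longrightarrow> y \<in> S \<Longrightarrow> x - y \<in> S"
proof -
  show *: "closed S" "0 \<in> S" "x \<in> S \<Longrightarrow> y \<in> S \<Longrightarrow> x + y \<in> S" 
    and sc: "x \<in> S \<Longrightarrow> scaleC z x \<in> S" for x y z
    using assms unfolding closed_csubspace_def by blast+
  show sR: "x \<in> S \<Longrightarrow> r *\<^sub>R x \<in> S" for x r using sc[of x "of_real r"] by (simp add: scaleC_of_real)
  show "x \<in> S \<Longrightarrow> y \<in> S \<Longrightarrow> x - y \<in> S" using *(3)[of x "(-1) *\<^sub>R y"] sR[of y "-1"] by simp
qed

lemma closed_csubspace_sum:
  assumes "closed_csubspace S" "\<And>i. i \<in> I \<Longrightarrow> f i \<in> S"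
  shows "(\<Sum>i\<in>I. f i) \<in> S"
  using assms(2) by (induction I rule: infinite_finite_induct) (auto simp: closed_csubspaceD[OF assms(1)])

lemma closed_csubspace_has_sum:
  assumes "closed_csubspace S" "\<And>i. i \<in> I \<Longrightarrow> f i \<in> S" "(f has_sum x) I"
  shows "x \<in> S"
  using assms(3) unfolding has_sum_def
  by (rule Lim_in_closed_set[OF closed_csubspaceD(1)[OF assms(1)], rotated 2])
     (auto intro!: eventually_finite_subsets_at_top_weakI closed_csubspace_sum[OF assms(1)] assms(2))

text \<open>By Zorn's lemma there is a maximal orthonormal set; a nonzero vector of \<open>S\<close> orthogonal to it
  could be normalized and added.\<close>

lemma onb_exists:
  assumes S: "closed_csubspace (S::'h::complex_hilbert set)"
  shows "\<exists>B. onb_of S B"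
proof -
  define \<A> where "\<A> = {B. B \<subseteq> S \<and> (\<forall>e\<in>B. \<forall>f\<in>B. cinner e f = (if e = f then 1 else 0))}"
  have "\<Union>C \<in> \<A>" if C: "subset.chain \<A> C" for C
  proof -
    have sub: "\<Union>C \<subseteq> S" using C unfolding subset_chain_def \<A>_def by auto
    have "cinner e f = (if e = f then 1 else 0)" if "e \<in> \<Union>C" "f \<in> \<Union>C" for e f
    proof -
      from that obtain M N where MN: "M \<in> C" "N \<in> C" "e \<in> M" "f \<in> N" by blast
      then have "M \<subseteq> N \<or> N \<subseteq> M" using C unfolding subset_chain_def by blast
      then have "\<exists>K\<in>C. e \<in> K \<and> f \<in> K" using MN by blast
      then obtain K where "K \<in> C" "e \<in> K" "f \<in> K" by blast
      moreover from this have "K \<in> \<A>" using C unfolding subset_chain_def by blast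
      ultimately show ?thesis unfolding \<A>_def by simp
    qed
    with sub show ?thesis unfolding \<A>_def by simp
  qed
  then obtain M where M: "M \<in> \<A>" and max: "\<And>X. X \<in> \<A> \<Longrightarrow> M \<subseteq> X \<Longrightarrow> X = M"
    using subset_Zorn'[of \<A>] by blast
  have "x = 0" if x: "x \<in> S" "\<forall>e\<in>M. cinner e x = 0" for x
  proof (rule ccontr)
    assume "x \<noteq> 0"
    define u where "u = (1 / norm x) *\<^sub>R x"
    have u: "u \<in> S" "norm u = 1" "\<And>e. e \<in> M \<Longrightarrow> cinner e u = 0"
      using x \<open>x \<noteq> 0\<close> closed_csubspaceD(5)[OF S] by (auto simp: u_def cinner_scaleR_right)
    then have u': "\<And>e. e \<in> M \<Longrightarrow> cinner u e = 0" by (metis cinner_commute complex_cnj_zero)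
    have uu: "cinner u u = 1" using u(2) by (simp add: cinner_self)
    have "u \<notin> M" using u(3) uu by force
    then have "insert u M \<in> \<A>" using M u(1,3) u' uu unfolding \<A>_def by auto
    from max[OF this] \<open>u \<notin> M\<close> show False by blast
  qed
  with M have "onb_of S M" by (simp add: \<A>_def onb_of_def)
  then show ?thesis ..
qed

text \<open>By Pythagoras, the partial sums over finite sets form a Cauchy filter: sets containing one that
  nearly exhausts the sum of squares differ from it by a vector of small norm. Such families are in
  general not absolutely summable.\<close>

lemma summable_orthogonal:
  fixes a :: "'h::complex_hilbert \<Rightarrow> complex"
  assumes B: "orthonormal B"
    and a: "(\<lambda>e. (cmod (a e))\<^sup>2) summable_on B"
  shows "(\<lambda>e. scaleC (a e) e) summable_on B"
proof -
  define s where "s = sum (\<lambda>e. (cmod (a e))\<^sup>2)"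
  define v where "v = sum (\<lambda>e. scaleC (a e) e)"
  define L where "L = infsum (\<lambda>e. (cmod (a e))\<^sup>2) B"
  have "\<exists>P. eventually P (finite_subsets_at_top B) \<and>
              (\<forall>F F'. P F \<and> P F' \<longrightarrow> dist (v F) (v F') < \<epsilon>)" if "\<epsilon> > 0" for \<epsilon>
  proof -
    have "(\<epsilon>/3)\<^sup>2 > 0" using that by simp
    from infsum_finite_approximation[OF a this] obtain F0
      where F0: "finite F0" "F0 \<subseteq> B" "dist (s F0) L \<le> (\<epsilon>/3)\<^sup>2"
      unfolding s_def L_def by blast
    define P where "P F \<longleftrightarrow> finite F \<and> F0 \<subseteq> F \<and> F \<subseteq> B" for F
    have near: "dist (v F) (v F0) \<le> \<epsilon>/3" if "P F" for F
    proof -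
      have F: "finite F" "F0 \<subseteq> F" "F \<subseteq> B" using that by (auto simp: P_def)
      have "(dist (v F) (v F0))\<^sup>2 = (norm (v (F - F0)))\<^sup>2"
        unfolding v_def dist_norm using F by (subst sum_diff) auto
      also have "\<dots> = s (F - F0)"
        unfolding v_def s_def by (rule norm_sum_orthonormal) (use F in \<open>auto intro: orthonormal_subset[OF B]\<close>)
      also have "\<dots> = s F - s F0"
        unfolding s_def using F by (simp add: sum_diff)
      also have "s F \<le> L"
        unfolding s_def L_def by (rule finite_sum_le_infsum[OF a]) (use F in auto)
      then have "s F - s F0 \<le> (\<epsilon>/3)\<^sup>2" using F0(3) by (simp add: dist_real_def)
      finally show ?thesis using \<open>\<epsilon> > 0\<close> by (simp add: power2_le_iff_abs_le)
    qed
    have "eventually P (finite_subsets_at_top B)"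
      unfolding eventually_finite_subsets_at_top P_def using F0 by blast
    moreover have "dist (v F) (v F') < \<epsilon>" if "P F" "P F'" for F F'
      using near[OF that(1)] near[OF that(2)] dist_triangle2[of "v F" "v F'" "v F0"] \<open>\<epsilon> > 0\<close> by linarith
    ultimately show ?thesis by blast
  qed
  then have "cauchy_filter (filtermap v (finite_subsets_at_top B))"
    by (simp add: cauchy_filter_metric_filtermap)
  moreover have "complete (UNIV::'h set)"
    by (meson Cauchy_convergent UNIV_I complete_def convergent_def)
  ultimately obtain L' where "(v \<longlongrightarrow> L') (finite_subsets_at_top B)"
    using complete_uniform[where S=UNIV] by (force simp add: filterlim_def)
  then show ?thesis
    unfolding v_def using summable_on_def has_sum_def by blast
qed

lemma square_summable_combination:
  fixes a :: "'h::complex_hilbert \<Rightarrow> complex"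
  assumes S: "closed_csubspace S" and B: "onb_of S B"
    and a: "(\<lambda>e. (cmod (a e))\<^sup>2) summable_on B"
  obtains w where "w \<in> S" "((\<lambda>e. scaleC (a e) e) has_sum w) B" "\<And>e. e \<in> B \<Longrightarrow> cinner e w = a e"
proof -
  obtain w where w: "((\<lambda>e. scaleC (a e) e) has_sum w) B"
    using summable_orthogonal[OF onb_ofD(2)[OF B] a] unfolding summable_on_def by blast
  have "w \<in> S"
    by (rule closed_csubspace_has_sum[OF S _ w]) (use onb_ofD(1)[OF B] closed_csubspaceD(4)[OF S] in auto)
  moreover have "cinner e w = a e" if e: "e \<in> B" for e
  proof -
    have "((\<lambda>f. cinner e (scaleC (a f) f)) has_sum cinner e w) B"
      by (rule has_sum_bounded_linear[OF bounded_linear_cinner_right w])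
    moreover have "((\<lambda>f. cinner e (scaleC (a f) f)) has_sum a e) B"
    proof (rule iffD2[OF has_sum_cong_neutral[where T = "{e}" and g = "\<lambda>f. a e"]])
      show "((\<lambda>f. a e) has_sum a e) {e}" by (rule has_sum_finiteI) auto
    qed (use e in \<open>auto simp: cinner_scaleC_right orthonormalD[OF onb_ofD(2)[OF B]]\<close>)
    ultimately show ?thesis by (rule has_sum_unique)
  qed
  ultimately show ?thesis using that w by blast
qed

text \<open>The finite sum is the orthogonal projection of \<open>x\<close> onto the span of \<open>F\<close>; in particular the
  right-hand side is nonnegative, which is Bessel's inequality.\<close>

lemma norm_minus_fourier:
  assumes F: "finite F" and on: "orthonormal F"
  shows "(norm (x - (\<Sum>e\<in>F. scaleC (cinner e x) e)))\<^sup>2 = (norm x)\<^sup>2 - (\<Sum>e\<in>F. (cmod (cinner e x))\<^sup>2)"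
proof -
  define p where "p = (\<Sum>e\<in>F. scaleC (cinner e x) e)"
  have px: "cinner p x = of_real (\<Sum>e\<in>F. (cmod (cinner e x))\<^sup>2)"
    by (simp only: p_def cinner_sum_left cinner_scaleC_left of_real_sum cnj_mult_self)
  have np: "(norm p)\<^sup>2 = (\<Sum>e\<in>F. (cmod (cinner e x))\<^sup>2)"
    unfolding p_def by (rule norm_sum_orthonormal[OF F on])
  have "cinner p (x - p) = 0" by (simp only: cinner_diff_right px cinner_self np diff_self)
  then have "(norm x)\<^sup>2 = (norm p)\<^sup>2 + (norm (x - p))\<^sup>2"
    using norm_add_orthogonal[of p "x - p"] by simp
  then show ?thesis unfolding np unfolding p_def by simp
qed

text \<open>By Bessel's inequality the series converges to some \<open>w\<close> in \<open>S\<close>. As \<open>x - w\<close> is orthogonal to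
  the whole basis, it is zero by maximality of the basis.\<close>

lemma fourier_expansion:
  fixes x :: "'h::complex_hilbert"
  assumes S: "closed_csubspace S" and B: "onb_of S B" and x: "x \<in> S"
  shows "((\<lambda>e. scaleC (cinner e x) e) has_sum x) B"
proof -
  have "(\<lambda>e. (cmod (cinner e x))\<^sup>2) summable_on B"
  proof (rule nonneg_bdd_above_summable_on)
    show "bdd_above (sum (\<lambda>e. (cmod (cinner e x))\<^sup>2) ` {F. F \<subseteq> B \<and> finite F})"
    proof (rule bdd_aboveI2)
      fix F assume F: "F \<in> {F. F \<subseteq> B \<and> finite F}"
      have "0 \<le> (norm x)\<^sup>2 - (\<Sum>e\<in>F. (cmod (cinner e x))\<^sup>2)"
        by (subst norm_minus_fourier[symmetric]) (use F in \<open>auto intro: orthonormal_subset[OF onb_ofD(2)[OF B]]\<close>)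
      then show "(\<Sum>e\<in>F. (cmod (cinner e x))\<^sup>2) \<le> (norm x)\<^sup>2" by simp
    qed
  qed auto
  from square_summable_combination[OF S B this] obtain w where w: "w \<in> S"
    "((\<lambda>e. scaleC (cinner e x) e) has_sum w) B" "\<And>e. e \<in> B \<Longrightarrow> cinner e w = cinner e x" by blast
  have "x - w = 0"
    by (rule onb_ofD(3)[OF B]) (use w x closed_csubspaceD(6)[OF S] in \<open>auto simp: cinner_diff_right\<close>)
  then show ?thesis using w(2) by simp
qed

lemma parseval:
  fixes x :: "'h::complex_hilbert"
  assumes S: "closed_csubspace S" and B: "onb_of S B" and x: "x \<in> S"
  shows "((\<lambda>e. (cmod (cinner e x))\<^sup>2) has_sum (norm x)\<^sup>2) B"
proof -
  have "((\<lambda>e. cinner x (scaleC (cinner e x) e)) has_sum cinner x x) B"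
    by (rule has_sum_bounded_linear[OF bounded_linear_cinner_right fourier_expansion[OF S B x]])
  moreover have "(\<lambda>e. cinner x (scaleC (cinner e x) e)) = (\<lambda>e. of_real ((cmod (cinner e x))\<^sup>2))"
  proof
    fix e
    have "cinner x e = cnj (cinner e x)" by (rule cinner_commute)
    then show "cinner x (scaleC (cinner e x) e) = of_real ((cmod (cinner e x))\<^sup>2)"
      by (simp only: cinner_scaleC_right complex_norm_square)
  qed
  ultimately have "((\<lambda>e. complex_of_real ((cmod (cinner e x))\<^sup>2)) has_sum of_real ((norm x)\<^sup>2)) B"
    by (simp only: cinner_self)
  from has_sum_Re[OF this] show ?thesis by (simp only: Re_complex_of_real)
qed

definition bounded_clinear :: "('h::complex_hilbert \<Rightarrow> 'h) \<Rightarrow> bool" where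
  "bounded_clinear T \<longleftrightarrow> bounded_linear T \<and> (\<forall>z x. T (scaleC z x) = scaleC z (T x))"

lemma bounded_clinearD:
  assumes "bounded_clinear T"
  shows "bounded_linear T" "T (scaleC z x) = scaleC z (T x)" "T (x + y) = T x + T y"
    "T (x - y) = T x - T y" "T (r *\<^sub>R x) = r *\<^sub>R T x" "T 0 = 0"
proof -
  show T: "bounded_linear T" and "T (scaleC z x) = scaleC z (T x)"
    using assms unfolding bounded_clinear_def by auto
  show "T (x + y) = T x + T y" "T (x - y) = T x - T y" "T (r *\<^sub>R x) = r *\<^sub>R T x" "T 0 = 0"
    by (rule linear_simps[OF T])+
qed

lemma bounded_clinear_compose:
  "bounded_clinear T \<Longrightarrow> bounded_clinear U \<Longrightarrow> bounded_clinear (\<lambda>x. U (T x))"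
  unfolding bounded_clinear_def using bounded_linear_compose[of U T] by auto

text \<open>The Riesz representation of the functional \<open>\<phi> v = \<langle>f, T v\<rangle>\<close>. The candidate is
  \<open>w = \<Sum>\<^sub>e cnj (\<phi> e) e\<close>. Its coefficients are square summable because a finite partial sum
  \<open>v\<close> of this series satisfies \<open>\<parallel>v\<parallel>\<^sup>2 = \<phi> v \<le> K \<parallel>v\<parallel>\<close>, so its norm is at most the bound \<open>K\<close> of
  \<open>\<phi>\<close>.\<close>

lemma riesz_adjoint:
  assumes S: "closed_csubspace S" and B: "onb_of S B" and T: "bounded_clinear T"
  shows "\<exists>w\<in>S. \<forall>v\<in>S. cinner f (T v) = cinner w v"
proof -
  define \<phi> where "\<phi> v = cinner f (T v)" for v
  obtain K where K: "\<And>v. cmod (\<phi> v) \<le> norm v * K"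
    using bounded_linear.bounded[OF bounded_linear_compose[OF bounded_linear_cinner_right bounded_clinearD(1)[OF T]]]
    unfolding \<phi>_def by blast
  have lin: "bounded_linear \<phi>"
    unfolding \<phi>_def by (rule bounded_linear_compose[OF bounded_linear_cinner_right bounded_clinearD(1)[OF T]])
  have sc: "\<phi> (scaleC z v) = z * \<phi> v" for z v
    by (simp add: \<phi>_def bounded_clinearD(2)[OF T] cinner_scaleC_right)
  have "(\<lambda>e. (cmod (cnj (\<phi> e)))\<^sup>2) summable_on B"
  proof (rule nonneg_bdd_above_summable_on)
    show "bdd_above (sum (\<lambda>e. (cmod (cnj (\<phi> e)))\<^sup>2) ` {F. F \<subseteq> B \<and> finite F})"
    proof (rule bdd_aboveI2)
      fix F assume F: "F \<in> {F. F \<subseteq> B \<and> finite F}"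
      define v where "v = (\<Sum>e\<in>F. scaleC (cnj (\<phi> e)) e)"
      define s where "s = (\<Sum>e\<in>F. (cmod (cnj (\<phi> e)))\<^sup>2)"
      have nv: "(norm v)\<^sup>2 = s"
        unfolding v_def s_def by (rule norm_sum_orthonormal) (use F in \<open>auto intro: orthonormal_subset[OF onb_ofD(2)[OF B]]\<close>)
      have "\<phi> v = of_real s"
        unfolding v_def s_def
        by (simp only: linear_sum[OF bounded_linear.linear[OF lin]] sc of_real_sum cnj_mult_self complex_mod_cnj)
      then have "cmod (\<phi> v) = (norm v)\<^sup>2" by (simp only: norm_of_real nv[symmetric] abs_power2)
      then have "norm v * norm v \<le> norm v * K" using K[of v] by (simp add: power2_eq_square)
      then have "norm v \<le> \<bar>K\<bar>"
        by (cases "norm v = 0") auto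
      then show "s \<le> \<bar>K\<bar>\<^sup>2" unfolding nv[symmetric] by (intro power_mono) auto
    qed
  qed auto
  from square_summable_combination[OF S B this] obtain w where w: "w \<in> S"
    "\<And>e. e \<in> B \<Longrightarrow> cinner e w = cnj (\<phi> e)" by blast
  then have we: "cinner w e = \<phi> e" if "e \<in> B" for e
    using that by (metis cinner_commute complex_cnj_cnj)
  have "\<phi> v = cinner w v" if v: "v \<in> S" for v
  proof -
    note ex = fourier_expansion[OF S B v]
    have "((\<lambda>e. cinner e v * \<phi> e) has_sum \<phi> v) B"
      using has_sum_bounded_linear[OF lin ex] by (simp add: sc)
    moreover have "((\<lambda>e. cinner e v * \<phi> e) has_sum cinner w v) B
        \<longleftrightarrow> ((\<lambda>e. cinner w (scaleC (cinner e v) e)) has_sum cinner w v) B"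
      by (rule has_sum_cong) (simp add: cinner_scaleC_right we)
    ultimately show ?thesis
      using has_sum_bounded_linear[OF bounded_linear_cinner_right ex, of w] has_sum_unique by blast
  qed
  then show ?thesis using w(1) unfolding \<phi>_def by blast
qed

section \<open>Hilbert--Schmidt operators\<close>

definition adjoint_on :: "'h::complex_hilbert set \<Rightarrow> ('h \<Rightarrow> 'h) \<Rightarrow> 'h \<Rightarrow> 'h" where
  "adjoint_on S T f = (SOME w. w \<in> S \<and> (\<forall>v\<in>S. cinner f (T v) = cinner w v))"

lemma adjoint_on:
  assumes "closed_csubspace S" and "bounded_clinear T"
  shows "adjoint_on S T f \<in> S" and "v \<in> S \<Longrightarrow> cinner f (T v) = cinner (adjoint_on S T f) v"
proof -
  obtain B where "onb_of S B" using onb_exists[OF assms(1)] by blast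
  then have "\<exists>w. w \<in> S \<and> (\<forall>v\<in>S. cinner f (T v) = cinner w v)"
    using riesz_adjoint[OF assms(1) _ assms(2)] by blast
  from someI_ex[OF this]
  show "adjoint_on S T f \<in> S" and "v \<in> S \<Longrightarrow> cinner f (T v) = cinner (adjoint_on S T f) v"
    unfolding adjoint_on_def by blast+
qed

lemma summable_on_Sigma_iff:
  fixes k :: "'a \<times> 'b \<Rightarrow> real"
  assumes "\<And>e. e \<in> B \<Longrightarrow> ((\<lambda>f. k (e, f)) has_sum g e) C" and "\<And>e f. k (e, f) \<ge> 0"
  shows "k summable_on B \<times> C \<longleftrightarrow> g summable_on B"
proof
  assume "k summable_on B \<times> C"
  then obtain s where "(k has_sum s) (B \<times> C)" unfolding summable_on_def by blast
  from has_sum_SigmaD[OF this] assms(1) have "(g has_sum s) B" by blast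
  then show "g summable_on B" unfolding summable_on_def by blast
next
  assume g: "g summable_on B"
  show "k summable_on B \<times> C"
    by (rule summable_on_SigmaI[OF _ g]) (use assms in auto)
qed

text \<open>Square summability of the matrix entries of \<open>T\<close>, summed one row at a time with Parseval's
  identity.\<close>

lemma matrix_summable_iff:
  assumes R: "closed_csubspace R" "onb_of R C" and T: "T ` B \<subseteq> R"
  shows "(\<lambda>(e, f). (cmod (cinner f (T e)))\<^sup>2) summable_on B \<times> C
    \<longleftrightarrow> (\<lambda>e. (norm (T e))\<^sup>2) summable_on B"
  by (rule summable_on_Sigma_iff) (use T parseval[OF R] in auto)

text \<open>Both conditions say that the matrix \<open>\<langle>f, T e\<rangle>\<close> is square summable: summing over \<open>f\<close> first
  gives \<open>\<parallel>T e\<parallel>\<^sup>2\<close>, summing over \<open>e\<close> first gives \<open>\<parallel>T\<^sup>* f\<parallel>\<^sup>2\<close>. The right-hand condition does not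
  depend on \<open>B\<close>, the left-hand one not on \<open>C\<close>, so neither depends on the basis.\<close>

lemma square_summable_iff_adjoint:
  assumes S: "closed_csubspace S" "onb_of S B" and R: "closed_csubspace R" "onb_of R C"
    and T: "bounded_clinear T" "T ` S \<subseteq> R"
  shows "(\<lambda>e. (norm (T e))\<^sup>2) summable_on B \<longleftrightarrow> (\<lambda>f. (norm (adjoint_on S T f))\<^sup>2) summable_on C"
proof -
  have "(\<lambda>e. (norm (T e))\<^sup>2) summable_on B
      \<longleftrightarrow> (\<lambda>(e, f). (cmod (cinner f (T e)))\<^sup>2) summable_on B \<times> C"
    by (rule matrix_summable_iff[OF R, symmetric]) (use T(2) onb_ofD(1)[OF S(2)] in auto)
  also have "\<dots> \<longleftrightarrow> (\<lambda>(f, e). (cmod (cinner f (T e)))\<^sup>2) summable_on C \<times> B"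
    by (subst summable_on_swap) simp
  also have "\<dots> \<longleftrightarrow> (\<lambda>f. (norm (adjoint_on S T f))\<^sup>2) summable_on C"
  proof (rule summable_on_Sigma_iff)
    fix f
    let ?w = "adjoint_on S T f"
    have "((\<lambda>e. (cmod (cinner e ?w))\<^sup>2) has_sum (norm ?w)\<^sup>2) B"
      by (rule parseval[OF S adjoint_on(1)[OF S(1) T(1)]])
    moreover have "cmod (cinner e ?w) = cmod (cinner f (T e))" if "e \<in> B" for e
    proof -
      have "cinner f (T e) = cinner ?w e"
        using adjoint_on(2)[OF S(1) T(1)] onb_ofD(1)[OF S(2)] that by blast
      then show ?thesis by (metis cinner_commute complex_mod_cnj)
    qed
    ultimately show "((\<lambda>e. case (f, e) of (f, e) \<Rightarrow> (cmod (cinner f (T e)))\<^sup>2) has_sum (norm ?w)\<^sup>2) B"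
      by (simp cong: has_sum_cong)
  qed auto
  finally show ?thesis .
qed

text \<open>Operators between subspaces are represented by operators on the whole space, so that the
  blocks of an operator, which are extended by zero, can be composed as functions.\<close>

definition hs_op :: "'h::complex_hilbert set \<Rightarrow> 'h set \<Rightarrow> ('h \<Rightarrow> 'h) \<Rightarrow> bool" where
  "hs_op S R T \<longleftrightarrow> bounded_clinear T \<and> T ` S \<subseteq> R \<and> hilbert_schmidt_on S T"

lemma hs_opD:
  assumes "hs_op S R T"
  shows "bounded_clinear T" "T ` S \<subseteq> R" "x \<in> S \<Longrightarrow> T x \<in> R"
  using assms unfolding hs_op_def by auto

lemma hs_op_square_summable:
  assumes S: "closed_csubspace S" and R: "closed_csubspace R" and T: "hs_op S R T" and B: "onb_of S B"
  shows "(\<lambda>e. (norm (T e))\<^sup>2) summable_on B"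
proof -
  obtain C where C: "onb_of R C" using onb_exists[OF R] by blast
  obtain B' where B': "onb_of S B'" "(\<lambda>e. (norm (T e))\<^sup>2) summable_on B'"
    using T unfolding hs_op_def hilbert_schmidt_on_def by blast
  show ?thesis
    using B'(2) square_summable_iff_adjoint[OF S B R C hs_opD(1,2)[OF T]]
      square_summable_iff_adjoint[OF S B'(1) R C hs_opD(1,2)[OF T]] by blast
qed

lemma hs_opI:
  assumes "closed_csubspace S" "bounded_clinear T" "\<And>x. x \<in> S \<Longrightarrow> T x \<in> R"
    and "\<And>B. onb_of S B \<Longrightarrow> (\<lambda>e. (norm (T e))\<^sup>2) summable_on B"
  shows "hs_op S R T"
  using assms(2-4) onb_exists[OF assms(1)] unfolding hs_op_def hilbert_schmidt_on_def by blast

lemma hs_op_dominated: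
  assumes S: "closed_csubspace S" "bounded_clinear T" "\<And>x. x \<in> S \<Longrightarrow> T x \<in> R"
    and g: "\<And>B. onb_of S B \<Longrightarrow> g summable_on B" and le: "\<And>e. (norm (T e))\<^sup>2 \<le> g e"
  shows "hs_op S R T"
proof (rule hs_opI[OF S])
  fix B assume "onb_of S B"
  then show "(\<lambda>e. (norm (T e))\<^sup>2) summable_on B"
    using summable_on_comparison_test[OF g] le by auto
qed

lemma hs_op_comp_left:
  assumes S: "closed_csubspace S" and R: "closed_csubspace R" and T: "hs_op S R T"
    and D: "bounded_clinear D" "\<And>x. x \<in> R \<Longrightarrow> D x \<in> R'"
  shows "hs_op S R' (\<lambda>x. D (T x))"
proof -
  obtain K where K: "\<And>x. norm (D x) \<le> norm x * K"
    using bounded_linear.bounded[OF bounded_clinearD(1)[OF D(1)]] by blast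
  show ?thesis
  proof (rule hs_op_dominated[OF S])
    show "(norm (D (T e)))\<^sup>2 \<le> K\<^sup>2 * (norm (T e))\<^sup>2" for e
      using power_mono[OF K[of "T e"], where n = 2] by (simp add: power_mult_distrib mult.commute)
    show "(\<lambda>e. K\<^sup>2 * (norm (T e))\<^sup>2) summable_on B" if "onb_of S B" for B
      by (rule summable_on_cmult_right[OF hs_op_square_summable[OF S R T that]])
  qed (use hs_opD[OF T] D in \<open>auto intro: bounded_clinear_compose\<close>)
qed

text \<open>In terms of adjoints, \<open>\<parallel>(T D)\<^sup>* f\<parallel> \<le> K \<parallel>T\<^sup>* f\<parallel>\<close> for a bound \<open>K\<close> of \<open>D\<close>. The adjoint of \<open>D\<close>
  itself is avoided by testing \<open>u = (T D)\<^sup>* f\<close> against itself: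
  \<open>\<parallel>u\<parallel>\<^sup>2 = \<langle>f, T D u\<rangle> = \<langle>T\<^sup>* f, D u\<rangle> \<le> K \<parallel>T\<^sup>* f\<parallel> \<parallel>u\<parallel>\<close>.\<close>

lemma hs_op_comp_right:
  assumes S: "closed_csubspace S" and R: "closed_csubspace R" and T: "hs_op S R T"
    and S': "closed_csubspace S'" and D: "bounded_clinear D" "\<And>x. x \<in> S' \<Longrightarrow> D x \<in> S"
  shows "hs_op S' R (\<lambda>x. T (D x))"
proof (rule hs_opI[OF S'])
  have bc: "bounded_clinear (\<lambda>x. T (D x))" 
    using hs_opD(1)[OF T] D(1) by (rule bounded_clinear_compose[rotated])
  then show "bounded_clinear (\<lambda>x. T (D x))" .
  show in_R: "\<And>x. x \<in> S' \<Longrightarrow> T (D x) \<in> R" using hs_opD(3)[OF T] D(2) by blast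
  obtain C where C: "onb_of R C" using onb_exists[OF R] by blast
  obtain B where B: "onb_of S B" using onb_exists[OF S] by blast
  obtain K where K: "\<And>x. norm (D x) \<le> norm x * K" and K0: "K \<ge> 0"
    using bounded_linear.nonneg_bounded[OF bounded_clinearD(1)[OF D(1)]] by blast
  have le: "norm (adjoint_on S' (\<lambda>x. T (D x)) f) \<le> K * norm (adjoint_on S T f)" for f
  proof -
    define u where "u = adjoint_on S' (\<lambda>x. T (D x)) f"
    define w where "w = adjoint_on S T f"
    have u: "u \<in> S'" unfolding u_def by (rule adjoint_on(1)[OF S' bc])
    have "cinner u u = cinner f (T (D u))"
      using adjoint_on(2)[OF S' bc u, of f] by (simp add: u_def)
    also have "\<dots> = cinner w (D u)"
      unfolding w_def by (rule adjoint_on(2)[OF S hs_opD(1)[OF T] D(2)[OF u]])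
    finally have "cmod (cinner u u) = cmod (cinner w (D u))"
      by (rule arg_cong)
    then have "(norm u)\<^sup>2 = cmod (cinner w (D u))"
      by (simp only: cinner_self norm_of_real abs_power2)
    also have "\<dots> \<le> norm w * (norm u * K)"
      by (rule order_trans[OF Cauchy_Schwarz_cinner]) (use K[of u] in \<open>auto intro: mult_left_mono\<close>)
    finally have "norm u * norm u \<le> norm u * (K * norm w)"
      by (simp add: power2_eq_square mult_ac)
    then show ?thesis unfolding u_def[symmetric] w_def[symmetric]
      using K0 by (cases "u = 0") auto
  qed
  fix B' assume B': "onb_of S' B'"
  have "(\<lambda>f. K\<^sup>2 * (norm (adjoint_on S T f))\<^sup>2) summable_on C"
    using hs_op_square_summable[OF S R T B] square_summable_iff_adjoint[OF S B R C hs_opD(1,2)[OF T]]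
    by (intro summable_on_cmult_right) blast
  then have "(\<lambda>f. (norm (adjoint_on S' (\<lambda>x. T (D x)) f))\<^sup>2) summable_on C"
    by (rule summable_on_comparison_test)
       (use power_mono[OF le, where n = 2] in \<open>auto simp: power_mult_distrib\<close>)
  moreover have "(\<lambda>x. T (D x)) ` S' \<subseteq> R" using in_R by blast
  ultimately show "(\<lambda>e. (norm (T (D e)))\<^sup>2) summable_on B'"
    using square_summable_iff_adjoint[OF S' B' R C bc] by blast
qed

lemma bounded_clinear_add:
  "bounded_clinear T \<Longrightarrow> bounded_clinear U \<Longrightarrow> bounded_clinear (\<lambda>x. T x + U x)"
  unfolding bounded_clinear_def by (simp add: bounded_linear_add scaleC_add_right)

lemma bounded_clinear_scaleR: "bounded_clinear T \<Longrightarrow> bounded_clinear (\<lambda>x. r *\<^sub>R T x)"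
  unfolding bounded_clinear_def
  using bounded_linear_compose[OF bounded_linear_scaleR_right, of T r]
  by (simp add: scaleC_scaleC mult.commute flip: scaleC_of_real)

lemma hs_op_add:
  assumes S: "closed_csubspace S" and R: "closed_csubspace R" and T: "hs_op S R T" and U: "hs_op S R U"
  shows "hs_op S R (\<lambda>x. T x + U x)"
proof (rule hs_op_dominated[OF S])
  show "bounded_clinear (\<lambda>x. T x + U x)"
    by (rule bounded_clinear_add[OF hs_opD(1)[OF T] hs_opD(1)[OF U]])
  show "T x + U x \<in> R" if "x \<in> S" for x
    using that hs_opD(3)[OF T] hs_opD(3)[OF U] closed_csubspaceD(3)[OF R] by blast
  show "(\<lambda>e. 2 * (norm (T e))\<^sup>2 + 2 * (norm (U e))\<^sup>2) summable_on B" if "onb_of S B" for B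
    by (intro summable_on_add summable_on_cmult_right hs_op_square_summable[OF S R] T U that)
  show "(norm (T e + U e))\<^sup>2 \<le> 2 * (norm (T e))\<^sup>2 + 2 * (norm (U e))\<^sup>2" for e
  proof -
    have "(norm (T e + U e))\<^sup>2 \<le> (norm (T e) + norm (U e))\<^sup>2"
      by (intro power_mono norm_triangle_ineq) auto
    also have "\<dots> \<le> 2 * (norm (T e))\<^sup>2 + 2 * (norm (U e))\<^sup>2"
      using zero_le_power2[of "norm (T e) - norm (U e)"] by (simp add: power2_sum power2_diff)
    finally show ?thesis .
  qed
qed

lemma hs_op_scaleR:
  assumes S: "closed_csubspace S" and R: "closed_csubspace R" and T: "hs_op S R T"
  shows "hs_op S R (\<lambda>x. r *\<^sub>R T x)"
proof (rule hs_op_comp_left[OF S R T])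
  show "bounded_clinear (\<lambda>x::'a. r *\<^sub>R x)"
    by (rule bounded_clinear_scaleR) (simp add: bounded_clinear_def bounded_linear_ident)
qed (rule closed_csubspaceD(5)[OF R])

lemma hs_op_diff:
  assumes S: "closed_csubspace S" and R: "closed_csubspace R" and T: "hs_op S R T" and U: "hs_op S R U"
  shows "hs_op S R (\<lambda>x. T x - U x)"
  using hs_op_add[OF S R T hs_op_scaleR[OF S R U, of "-1"]] by simp

section \<open>The trace\<close>

text \<open>Both families arise from \<open>k(e, f) = \<langle>e, U f\<rangle> \<langle>f, T e\<rangle>\<close> by summing out one index, by the
  Fourier expansions of \<open>T e\<close> and \<open>U f\<close>. The family \<open>k\<close> is absolutely summable because the
  matrices of \<open>T\<close> and \<open>U\<close> are square summable, so the order of summation does not matter.\<close>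

lemma has_sum_trace_exchange:
  assumes S: "closed_csubspace S" and R: "closed_csubspace R"
    and T: "hs_op S R T" and U: "hs_op R S U" and B: "onb_of S B" and C: "onb_of R C"
  shows "\<exists>t. ((\<lambda>e. cinner e (U (T e))) has_sum t) B \<and> ((\<lambda>f. cinner f (T (U f))) has_sum t) C"
proof -
  define k where "k = (\<lambda>(e, f). cinner e (U f) * cinner f (T e))"
  have TB: "T ` B \<subseteq> R" and UC: "U ` C \<subseteq> S"
    using hs_opD(3)[OF T] hs_opD(3)[OF U] onb_ofD(1)[OF B] onb_ofD(1)[OF C] by auto
  have "(\<lambda>(e, f). (cmod (cinner f (T e)))\<^sup>2) summable_on B \<times> C"
    unfolding matrix_summable_iff[OF R C TB] by (rule hs_op_square_summable[OF S R T B])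
  moreover have "(\<lambda>(f, e). (cmod (cinner e (U f)))\<^sup>2) summable_on C \<times> B"
    unfolding matrix_summable_iff[OF S B UC] by (rule hs_op_square_summable[OF R S U C])
  then have "(\<lambda>(e, f). (cmod (cinner e (U f)))\<^sup>2) summable_on B \<times> C"
    by (subst summable_on_swap) simp
  ultimately have "(\<lambda>p. (case p of (e, f) \<Rightarrow> (cmod (cinner e (U f)))\<^sup>2)
      + (case p of (e, f) \<Rightarrow> (cmod (cinner f (T e)))\<^sup>2)) summable_on B \<times> C"
    by (intro summable_on_add)
  then have "(\<lambda>p. norm (k p)) summable_on B \<times> C"
  proof (rule Infinite_Sum.abs_summable_on_comparison_test')
    fix p :: "'a \<times> 'a"
    obtain e f where p: "p = (e, f)" by force
    define a b where "a = cmod (cinner e (U f))" and "b = cmod (cinner f (T e))"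
    have "2 * (a * b) \<le> a\<^sup>2 + b\<^sup>2" using zero_le_power2[of "a - b"] by (simp add: power2_diff)
    moreover have "a * b \<ge> 0" by (simp add: a_def b_def)
    ultimately have "a * b \<le> a\<^sup>2 + b\<^sup>2" by linarith
    then show "norm (k p) \<le> (case p of (e, f) \<Rightarrow> (cmod (cinner e (U f)))\<^sup>2)
      + (case p of (e, f) \<Rightarrow> (cmod (cinner f (T e)))\<^sup>2)"
      by (simp add: k_def p norm_mult a_def b_def)
  qed
  then have "k summable_on B \<times> C" by (rule Infinite_Sum.abs_summable_summable)
  then obtain t where t: "(k has_sum t) (B \<times> C)" unfolding summable_on_def by blast
  have expand: "((\<lambda>f. cinner e (U f) * cinner f x) has_sum cinner e (U x)) C"
    if "bounded_clinear U" "closed_csubspace R" "onb_of R C" "x \<in> R" for e x :: 'a and U R C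
    using has_sum_bounded_linear[OF bounded_linear_compose[OF bounded_linear_cinner_right
        bounded_clinearD(1)[OF that(1)]] fourier_expansion[OF that(2-4)], of e]
    by (simp add: bounded_clinearD(2)[OF that(1)] cinner_scaleC_right mult.commute)
  have "((\<lambda>e. cinner e (U (T e))) has_sum t) B"
    by (rule has_sum_SigmaD[OF t])
       (use expand[OF hs_opD(1)[OF U] R C] hs_opD(3)[OF T] onb_ofD(1)[OF B] in \<open>auto simp: k_def\<close>)
  moreover have "((\<lambda>f. cinner f (T (U f))) has_sum t) C"
  proof (rule has_sum_SigmaD[OF iffD1[OF has_sum_swap t]])
    fix f assume "f \<in> C"
    then have "U f \<in> S" using hs_opD(3)[OF U] onb_ofD(1)[OF C] by blast
    from expand[OF hs_opD(1)[OF T] S B this, of f]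
    show "((\<lambda>e. case (f, e) of (f, e) \<Rightarrow> k (e, f)) has_sum cinner f (T (U f))) B"
      by (simp add: k_def mult.commute)
  qed
  ultimately show ?thesis by blast
qed

lemma someI_onb: "closed_csubspace S \<Longrightarrow> onb_of S (SOME B. onb_of S B)"
  by (rule someI_ex[OF onb_exists])

lemma trace_summable:
  assumes "closed_csubspace S" "closed_csubspace R" "hs_op S R T" "hs_op R S U"
  shows "(\<lambda>e. cinner e (U (T e))) summable_on (SOME B. onb_of S B)"
  using has_sum_trace_exchange[OF assms someI_onb someI_onb] assms(1,2) summable_on_def by blast

text \<open>The trace on either side is taken over an arbitrary chosen basis, which is harmless since
  Hilbert--Schmidt operators are square summable along every basis.\<close>

lemma trace_cyclic:
  assumes "closed_csubspace S" "closed_csubspace R" "hs_op S R T" "hs_op R S U"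
  shows "trace_on S (\<lambda>x. U (T x)) = trace_on R (\<lambda>x. T (U x))"
  using has_sum_trace_exchange[OF assms someI_onb[OF assms(1)] someI_onb[OF assms(2)]] infsumI
  unfolding trace_on_def by metis

section \<open>Blocks with respect to a polarization\<close>

lemma polarization_sym: "polarization Hp Hm \<Longrightarrow> polarization Hm Hp"
proof -
  assume P: "polarization Hp Hm"
  have "cinner x y = 0" if "x \<in> Hm" "y \<in> Hp" for x y
    using P that cinner_commute[of x y] by (simp add: polarization_def)
  moreover have "\<exists>u\<in>Hm. \<exists>v\<in>Hp. x = u + v" for x
  proof -
    obtain u v where "u \<in> Hp" "v \<in> Hm" "x = u + v" using P unfolding polarization_def by blast
    then show ?thesis using add.commute[of u v] by auto
  qed
  ultimately show ?thesis using P by (simp add: polarization_def)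
qed

lemma polarizationD:
  assumes "polarization Hp Hm"
  shows "closed_csubspace Hp" "closed_csubspace Hm" "u \<in> Hp \<Longrightarrow> v \<in> Hm \<Longrightarrow> cinner u v = 0"
  using assms unfolding polarization_def by auto

text \<open>The description of \<open>oproj\<close> by orthogonality has at most one solution: two of them differ by a
  vector of \<open>Hp\<close> orthogonal to \<open>Hp\<close>.\<close>

lemma oproj_add:
  assumes P: "polarization Hp Hm" and u: "u \<in> Hp" and v: "v \<in> Hm"
  shows "oproj Hp (u + v) = u"
  unfolding oproj_def
proof (rule the_equality)
  show "u \<in> Hp \<and> (\<forall>w\<in>Hp. cinner w (u + v - u) = 0)"
    using u v polarizationD(3)[OF P] by simp
next
  fix u' assume u': "u' \<in> Hp \<and> (\<forall>w\<in>Hp. cinner w (u + v - u') = 0)"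
  have d: "u - u' \<in> Hp" using closed_csubspaceD(6)[OF polarizationD(1)[OF P]] u u' by blast
  have "cinner (u - u') (u - u') = cinner (u - u') (u + v - u') - cinner (u - u') v"
    by (simp flip: cinner_diff_right)
  also have "\<dots> = 0" using u' d polarizationD(3)[OF P d v] by simp
  finally show "u' = u" by (simp add: cinner_self)
qed

lemma oproj_split:
  assumes P: "polarization Hp Hm"
  obtains u v where "u \<in> Hp" "v \<in> Hm" "x = u + v" "oproj Hp x = u" "oproj Hm x = v"
proof -
  obtain u v where uv: "u \<in> Hp" "v \<in> Hm" "x = u + v" using P unfolding polarization_def by blast
  moreover have "oproj Hm x = v"
    using oproj_add[OF polarization_sym[OF P] uv(2,1)] uv(3) by (simp add: add.commute)
  ultimately show ?thesis using that oproj_add[OF P uv(1,2)] by blast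
qed

lemma oproj_in: "polarization Hp Hm \<Longrightarrow> oproj Hp x \<in> Hp"
  by (erule oproj_split[where x = x]) simp

lemma oproj_id: "polarization Hp Hm \<Longrightarrow> x \<in> Hp \<Longrightarrow> oproj Hp x = x"
  using oproj_add[of Hp Hm x 0] by (simp add: closed_csubspaceD(2)[OF polarizationD(2)])

lemma oproj_sum: "polarization Hp Hm \<Longrightarrow> oproj Hp x + oproj Hm x = x"
  by (erule oproj_split[where x = x]) simp

lemma bounded_clinear_oproj:
  assumes P: "polarization Hp Hm"
  shows "bounded_clinear (oproj Hp)"
proof -
  note S = polarizationD(1)[OF P] and R = polarizationD(2)[OF P]
  have sc: "oproj Hp (scaleC z x) = scaleC z (oproj Hp x)" for z x
  proof -
    obtain u v where uv: "u \<in> Hp" "v \<in> Hm" "x = u + v" "oproj Hp x = u" by (rule oproj_split[OF P])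
    then show ?thesis
      using oproj_add[OF P closed_csubspaceD(4)[OF S uv(1)] closed_csubspaceD(4)[OF R uv(2)], of z z]
      by (simp add: scaleC_add_right)
  qed
  have "bounded_linear (oproj Hp)"
  proof (rule bounded_linear_intro[where K = 1])
    fix x y
    obtain u v where uv: "u \<in> Hp" "v \<in> Hm" "x = u + v" "oproj Hp x = u" by (rule oproj_split[OF P])
    obtain u' v' where uv': "u' \<in> Hp" "v' \<in> Hm" "y = u' + v'" "oproj Hp y = u'" by (rule oproj_split[OF P])
    have "oproj Hp ((u + u') + (v + v')) = u + u'"
      by (rule oproj_add[OF P closed_csubspaceD(3)[OF S uv(1) uv'(1)] closed_csubspaceD(3)[OF R uv(2) uv'(2)]])
    then show "oproj Hp (x + y) = oproj Hp x + oproj Hp y"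
      using uv uv' by (simp add: algebra_simps)
  next
    fix r x show "oproj Hp (r *\<^sub>R x) = r *\<^sub>R oproj Hp x" by (simp add: sc flip: scaleC_of_real)
  next
    fix x
    obtain u v where uv: "u \<in> Hp" "v \<in> Hm" "x = u + v" "oproj Hp x = u" by (rule oproj_split[OF P])
    have "(norm u)\<^sup>2 \<le> (norm (u + v))\<^sup>2"
      using norm_add_orthogonal[OF polarizationD(3)[OF P uv(1,2)]] by simp
    then have "norm u \<le> norm (u + v)" by (rule power2_le_imp_le) simp
    then show "norm (oproj Hp x) \<le> norm x * 1" using uv by simp
  qed
  then show ?thesis using sc unfolding bounded_clinear_def by blast
qed

lemma blinfun_bounded_clinear: "complex_linear_op A \<Longrightarrow> bounded_clinear (blinfun_apply A)"
  unfolding complex_linear_op_def bounded_clinear_def by (simp add: blinfun.bounded_linear_right)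

text \<open>Block matrix multiplication: the identity, inserted between the two factors, is the sum of the
  two orthogonal projections.\<close>

lemma block_comp:
  assumes P: "polarization Hp Hm" and S: "S = Hp \<or> S = Hm"
  shows "block S R (A o\<^sub>L B) x = block S Hp A (block Hp R B x) + block S Hm A (block Hm R B x)"
proof -
  define y where "y = blinfun_apply B (oproj R x)"
  note P' = polarization_sym[OF P]
  have "bounded_clinear (oproj S)"
    using S bounded_clinear_oproj[OF P] bounded_clinear_oproj[OF P'] by blast
  note oS = bounded_clinearD(3)[OF this]
  have "oproj S (blinfun_apply A y) = oproj S (blinfun_apply A (oproj Hp y + oproj Hm y))"
    by (simp only: oproj_sum[OF P])
  then show ?thesis
    by (simp add: block_def y_def[symmetric] blinfun.add_right oS
        oproj_id[OF P oproj_in[OF P]] oproj_id[OF P' oproj_in[OF P']])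
qed

section \<open>The Schwinger cocycle\<close>

lemma infsum_diff:
  fixes f g :: "'a \<Rightarrow> 'b::{topological_ab_group_add, t2_space}"
  assumes "f summable_on A" "g summable_on A"
  shows "infsum (\<lambda>x. f x - g x) A = infsum f A - infsum g A"
  using infsum_add[OF assms(1) iffD2[OF summable_on_uminus assms(2)]] by (simp add: infsum_uminus)

context
  fixes Hp Hm :: "'h::complex_hilbert set"
  assumes P: "polarization Hp Hm"
begin

lemma closed_Hp: "closed_csubspace Hp" and closed_Hm: "closed_csubspace Hm"
  using polarizationD[OF P] by auto

lemma polarization_swapped: "polarization Hm Hp"
  by (rule polarization_sym[OF P])

lemma oproj_component:
  assumes "S \<in> {Hp, Hm}"
  shows "bounded_clinear (oproj S)" and "oproj S x \<in> S"
proof -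
  have "S = Hp \<or> S = Hm" using assms by simp
  then show "bounded_clinear (oproj S)" and "oproj S x \<in> S"
    using bounded_clinear_oproj[OF P] bounded_clinear_oproj[OF polarization_swapped] oproj_in[OF P] oproj_in[OF polarization_swapped]
    by (elim disjE; simp)+
qed

lemma bounded_clinear_block:
  assumes "complex_linear_op A" "S \<in> {Hp, Hm}" "R \<in> {Hp, Hm}"
  shows "bounded_clinear (block S R A)" and "block S R A x \<in> S"
proof -
  show "block S R A x \<in> S" unfolding block_def by (rule oproj_component(2)[OF assms(2)])
  have "bounded_clinear (\<lambda>x. oproj S (blinfun_apply A (oproj R x)))"
    by (rule bounded_clinear_compose[OF bounded_clinear_compose[OF oproj_component(1)[OF assms(3)]
            blinfun_bounded_clinear[OF assms(1)]] oproj_component(1)[OF assms(2)]])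
  then show "bounded_clinear (block S R A)"
    unfolding block_def[abs_def] .
qed

lemma block_linear:
  assumes "S \<in> {Hp, Hm}"
  shows "block S R (A + B) x = block S R A x + block S R B x"
    and "block S R (A - B) x = block S R A x - block S R B x"
    and "block S R (r *\<^sub>R A) x = r *\<^sub>R block S R A x"
  by (simp_all only: block_def blinfun.add_left blinfun.diff_left blinfun.scaleR_left
      bounded_clinearD(3-5)[OF oproj_component(1)[OF assms]])

lemma gl_resD:
  assumes "A \<in> lie_carrier (gl_res Hp Hm)"
  shows "complex_linear_op A" "hs_op Hm Hp (block Hp Hm A)" "hs_op Hp Hm (block Hm Hp A)"
proof -
  show A: "complex_linear_op A" using assms by (simp add: gl_res_def)
  show "hs_op Hm Hp (block Hp Hm A)" "hs_op Hp Hm (block Hm Hp A)"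
    using assms bounded_clinear_block[OF A, of Hp Hm] bounded_clinear_block[OF A, of Hm Hp]
    unfolding hs_op_def by (simp_all add: gl_res_def image_subset_iff)
qed

text \<open>The trace of a product of two off-diagonal blocks \<open>T : H\<^sub>- \<rightarrow> H\<^sub>+\<close> and \<open>U : H\<^sub>+ \<rightarrow> H\<^sub>-\<close> as a
  function of the factors: it is bilinear on Hilbert--Schmidt operators.\<close>

definition pairing :: "('h \<Rightarrow> 'h) \<Rightarrow> ('h \<Rightarrow> 'h) \<Rightarrow> complex" where
  "pairing U T = trace_on Hm (\<lambda>x. U (T x))"

abbreviation (input) "hs_plus \<equiv> hs_op Hp Hm"
abbreviation (input) "hs_minus \<equiv> hs_op Hm Hp"

lemmas pairing_summable = trace_summable[OF closed_Hm closed_Hp]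

lemma pairing_diff:
  assumes "hs_minus T" "hs_plus U" "hs_minus T'" "hs_plus U'"
  shows "trace_on Hm (\<lambda>x. U (T x) - U' (T' x)) = pairing U T - pairing U' T'"
  unfolding pairing_def trace_on_def cinner_diff_right
  by (rule infsum_diff; rule pairing_summable) fact+

lemma pairing_add_left:
  assumes "hs_minus T" "hs_plus U" "hs_plus U'"
  shows "pairing (\<lambda>x. U x + U' x) T = pairing U T + pairing U' T"
  unfolding pairing_def trace_on_def cinner_add_right
  by (rule infsum_add; rule pairing_summable) fact+

lemma pairing_diff_left:
  assumes "hs_minus T" "hs_plus U" "hs_plus U'"
  shows "pairing (\<lambda>x. U x - U' x) T = pairing U T - pairing U' T"
  unfolding pairing_def trace_on_def cinner_diff_right
  by (rule infsum_diff; rule pairing_summable) fact+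

lemma pairing_add_right:
  assumes "hs_minus T" "hs_minus T'" "hs_plus U"
  shows "pairing U (\<lambda>x. T x + T' x) = pairing U T + pairing U T'"
  unfolding pairing_def trace_on_def bounded_clinearD(3)[OF hs_opD(1)[OF assms(3)]] cinner_add_right
  by (rule infsum_add; rule pairing_summable) fact+

lemma pairing_diff_right:
  assumes "hs_minus T" "hs_minus T'" "hs_plus U"
  shows "pairing U (\<lambda>x. T x - T' x) = pairing U T - pairing U T'"
  unfolding pairing_def trace_on_def bounded_clinearD(4)[OF hs_opD(1)[OF assms(3)]] cinner_diff_right
  by (rule infsum_diff; rule pairing_summable) fact+

lemma pairing_scaleR:
  assumes "hs_plus U"
  shows "pairing (\<lambda>x. r *\<^sub>R U x) T = of_real r * pairing U T"
    and "pairing U (\<lambda>x. r *\<^sub>R T x) = of_real r * pairing U T"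
  unfolding pairing_def trace_on_def bounded_clinearD(5)[OF hs_opD(1)[OF assms]] cinner_scaleR_right
  by (rule infsum_cmult_right')+

text \<open>\<open>Tr(D U T) = Tr(T D U) = Tr(U T D)\<close>, where the middle trace is taken over \<open>H\<^sub>+\<close>. Exchanging the
  two Hilbert--Schmidt factors twice avoids the cyclicity of the trace for a trace class and a
  bounded operator.\<close>

lemma pairing_move:
  assumes T: "hs_minus T" and U: "hs_plus U" and D: "bounded_clinear D" "\<And>x. D x \<in> Hm"
  shows "pairing (\<lambda>x. D (U x)) T = pairing U (\<lambda>x. T (D x))"
proof -
  have DU: "hs_plus (\<lambda>x. D (U x))" by (rule hs_op_comp_left[OF closed_Hp closed_Hm U D])
  have TD: "hs_minus (\<lambda>x. T (D x))" by (rule hs_op_comp_right[OF closed_Hm closed_Hp T closed_Hm D])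
  show ?thesis
    unfolding pairing_def using trace_cyclic[OF closed_Hm closed_Hp T DU] trace_cyclic[OF closed_Hm closed_Hp TD U] by simp
qed

lemma schwinger_eq_pairing:
  assumes "A \<in> lie_carrier (gl_res Hp Hm)" "B \<in> lie_carrier (gl_res Hp Hm)"
  shows "schwinger_cocycle Hp Hm A B
    = pairing (block Hm Hp A) (block Hp Hm B) - pairing (block Hm Hp B) (block Hp Hm A)"
  unfolding schwinger_cocycle_def
  by (rule pairing_diff[OF gl_resD(2)[OF assms(2)] gl_resD(3)[OF assms(1)]
      gl_resD(2)[OF assms(1)] gl_resD(3)[OF assms(2)]])

text \<open>In the names of the blocks, the first letter gives the target and the second the source, as in
  the subscripts of \<open>A\<^sub>-\<^sub>+ : H\<^sub>+ \<rightarrow> H\<^sub>-\<close>.\<close>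

abbreviation (input) "\<gg>\<ll> \<equiv> lie_carrier (gl_res Hp Hm)"
abbreviation (input) "pp \<equiv> block Hp Hp"
abbreviation (input) "pm \<equiv> block Hp Hm"
abbreviation (input) "mp \<equiv> block Hm Hp"
abbreviation (input) "mm \<equiv> block Hm Hm"
abbreviation (input) "bracket A B \<equiv> (A o\<^sub>L B) - (B o\<^sub>L A)"

lemma hs_block_comp:
  assumes A: "A \<in> \<gg>\<ll>" and B: "B \<in> \<gg>\<ll>"
  shows "hs_plus (\<lambda>x. mp A (pp B x))" "hs_plus (\<lambda>x. mm A (mp B x))"
    "hs_minus (\<lambda>x. pp A (pm B x))" "hs_minus (\<lambda>x. pm A (mm B x))"
proof -
  have pp: "bounded_clinear (pp X)" "pp X x \<in> Hp" and mm: "bounded_clinear (mm X)" "mm X x \<in> Hm"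
    if "X \<in> \<gg>\<ll>" for X x
    using bounded_clinear_block[OF gl_resD(1)[OF that], of Hp Hp]
      bounded_clinear_block[OF gl_resD(1)[OF that], of Hm Hm] by simp_all
  show "hs_plus (\<lambda>x. mp A (pp B x))"
    by (rule hs_op_comp_right[OF closed_Hp closed_Hm gl_resD(3)[OF A] closed_Hp pp[OF B]])
  show "hs_plus (\<lambda>x. mm A (mp B x))"
    by (rule hs_op_comp_left[OF closed_Hp closed_Hm gl_resD(3)[OF B] mm[OF A]])
  show "hs_minus (\<lambda>x. pp A (pm B x))"
    by (rule hs_op_comp_left[OF closed_Hm closed_Hp gl_resD(2)[OF B] pp[OF A]])
  show "hs_minus (\<lambda>x. pm A (mm B x))"
    by (rule hs_op_comp_right[OF closed_Hm closed_Hp gl_resD(2)[OF A] closed_Hm mm[OF B]])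
qed

lemma block_bracket:
  "mp (bracket A B) = (\<lambda>x. (mp A (pp B x) + mm A (mp B x)) - (mp B (pp A x) + mm B (mp A x)))"
  "pm (bracket A B) = (\<lambda>x. (pp A (pm B x) + pm A (mm B x)) - (pp B (pm A x) + pm B (mm A x)))"
  by (simp_all add: fun_eq_iff block_linear block_comp[OF P])

lemma gl_res_closed:
  assumes A: "A \<in> \<gg>\<ll>" and B: "B \<in> \<gg>\<ll>"
  shows "A + B \<in> \<gg>\<ll>" "r *\<^sub>R A \<in> \<gg>\<ll>" "bracket A B \<in> \<gg>\<ll>"
proof -
  have I: "X \<in> \<gg>\<ll>" if "complex_linear_op X" "hs_minus (pm X)" "hs_plus (mp X)" for X
    using that unfolding hs_op_def by (simp add: gl_res_def)
  have lin: "blinfun_apply A (scaleC z x) = scaleC z (blinfun_apply A x)"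
    "blinfun_apply B (scaleC z x) = scaleC z (blinfun_apply B x)" for z x
    using gl_resD(1)[OF A] gl_resD(1)[OF B] by (simp_all add: complex_linear_op_def)
  have scaleC_minus: "scaleC z (x - y) = scaleC z x - scaleC z y" for z and x y :: 'h
    using scaleC_add_right[of z "x - y" y] by simp
  have sum: "block S R (A + B) = (\<lambda>x. block S R A x + block S R B x)"
    and scale: "block S R (r *\<^sub>R A) = (\<lambda>x. r *\<^sub>R block S R A x)" if "S \<in> {Hp, Hm}" for S R
    using that by (simp_all add: fun_eq_iff block_linear)
  show "A + B \<in> \<gg>\<ll>"
  proof (rule I)
    show "complex_linear_op (A + B)"
      by (simp add: complex_linear_op_def blinfun.add_left lin scaleC_add_right)
    show "hs_minus (pm (A + B))" "hs_plus (mp (A + B))"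
      using hs_op_add[OF closed_Hm closed_Hp gl_resD(2)[OF A] gl_resD(2)[OF B]]
        hs_op_add[OF closed_Hp closed_Hm gl_resD(3)[OF A] gl_resD(3)[OF B]] by (simp_all add: sum)
  qed
  show "r *\<^sub>R A \<in> \<gg>\<ll>"
  proof (rule I)
    show "complex_linear_op (r *\<^sub>R A)"
      by (simp add: complex_linear_op_def blinfun.scaleR_left lin scaleC_scaleC mult.commute
          flip: scaleC_of_real)
    show "hs_minus (pm (r *\<^sub>R A))" "hs_plus (mp (r *\<^sub>R A))"
      using hs_op_scaleR[OF closed_Hm closed_Hp gl_resD(2)[OF A]] hs_op_scaleR[OF closed_Hp closed_Hm gl_resD(3)[OF A]]
      by (simp_all add: scale)
  qed
  show "bracket A B \<in> \<gg>\<ll>"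
  proof (rule I)
    show "complex_linear_op (bracket A B)"
      by (simp add: complex_linear_op_def blinfun.diff_left lin scaleC_minus)
    show "hs_minus (pm (bracket A B))" unfolding block_bracket
      by (intro hs_op_diff[OF closed_Hm closed_Hp] hs_op_add[OF closed_Hm closed_Hp] hs_block_comp A B)
    show "hs_plus (mp (bracket A B))" unfolding block_bracket
      by (intro hs_op_diff[OF closed_Hp closed_Hm] hs_op_add[OF closed_Hp closed_Hm] hs_block_comp A B)
  qed
qed

text \<open>In all terms the diagonal block now stands in the right factor: \<open>X\<^sub>+\<^sub>+\<close> by associativity and
  \<open>X\<^sub>-\<^sub>-\<close> by the trace property. In this normal form equal contributions to the cyclic sum are
  syntactically equal.\<close>

lemma pairing_bracket:
  assumes A: "A \<in> \<gg>\<ll>" and B: "B \<in> \<gg>\<ll>" and C: "C \<in> \<gg>\<ll>"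
  shows "pairing (mp (bracket A B)) (pm C)
      = pairing (mp A) (\<lambda>x. pp B (pm C x)) + pairing (mp B) (\<lambda>x. pm C (mm A x))
      - (pairing (mp B) (\<lambda>x. pp A (pm C x)) + pairing (mp A) (\<lambda>x. pm C (mm B x)))"
    and "pairing (mp C) (pm (bracket A B))
      = pairing (mp C) (\<lambda>x. pp A (pm B x)) + pairing (mp C) (\<lambda>x. pm A (mm B x))
      - (pairing (mp C) (\<lambda>x. pp B (pm A x)) + pairing (mp C) (\<lambda>x. pm B (mm A x)))"
proof -
  have move: "pairing (\<lambda>x. mm X (mp Y x)) (pm C) = pairing (mp Y) (\<lambda>x. pm C (mm X x))"
    if "X \<in> \<gg>\<ll>" "Y \<in> \<gg>\<ll>" for X Y
    by (rule pairing_move[OF gl_resD(2)[OF C] gl_resD(3)[OF that(2)]])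
       (use bounded_clinear_block[OF gl_resD(1)[OF that(1)], of Hm Hm] in simp_all)
  have assoc: "pairing (\<lambda>x. mp X (pp Y x)) (pm C) = pairing (mp X) (\<lambda>x. pp Y (pm C x))" for X Y
    by (simp add: pairing_def)
  have left: "pairing (\<lambda>x. mp X (pp Y x) + mm X (mp Y x)) (pm C)
      = pairing (mp X) (\<lambda>x. pp Y (pm C x)) + pairing (mp Y) (\<lambda>x. pm C (mm X x))"
    if "X \<in> \<gg>\<ll>" "Y \<in> \<gg>\<ll>" for X Y
    unfolding pairing_add_left[OF gl_resD(2)[OF C] hs_block_comp(1,2)[OF that]] move[OF that] assoc ..
  have sum: "hs_plus (\<lambda>x. mp X (pp Y x) + mm X (mp Y x))"
      "hs_minus (\<lambda>x. pp X (pm Y x) + pm X (mm Y x))" if "X \<in> \<gg>\<ll>" "Y \<in> \<gg>\<ll>" for X Y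
    by (rule hs_op_add[OF closed_Hp closed_Hm hs_block_comp(1,2)[OF that]],
        rule hs_op_add[OF closed_Hm closed_Hp hs_block_comp(3,4)[OF that]])
  show "pairing (mp (bracket A B)) (pm C)
      = pairing (mp A) (\<lambda>x. pp B (pm C x)) + pairing (mp B) (\<lambda>x. pm C (mm A x))
      - (pairing (mp B) (\<lambda>x. pp A (pm C x)) + pairing (mp A) (\<lambda>x. pm C (mm B x)))"
    unfolding block_bracket pairing_diff_left[OF gl_resD(2)[OF C] sum(1)[OF A B] sum(1)[OF B A]]
      left[OF A B] left[OF B A] ..
  have right: "pairing (mp C) (\<lambda>x. pp X (pm Y x) + pm X (mm Y x))
      = pairing (mp C) (\<lambda>x. pp X (pm Y x)) + pairing (mp C) (\<lambda>x. pm X (mm Y x))"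
    if "X \<in> \<gg>\<ll>" "Y \<in> \<gg>\<ll>" for X Y
    by (rule pairing_add_right[OF hs_block_comp(3,4)[OF that] gl_resD(3)[OF C]])
  show "pairing (mp C) (pm (bracket A B))
      = pairing (mp C) (\<lambda>x. pp A (pm B x)) + pairing (mp C) (\<lambda>x. pm A (mm B x))
      - (pairing (mp C) (\<lambda>x. pp B (pm A x)) + pairing (mp C) (\<lambda>x. pm B (mm A x)))"
    unfolding block_bracket pairing_diff_right[OF sum(2)[OF A B] sum(2)[OF B A] gl_resD(3)[OF C]]
      right[OF A B] right[OF B A] ..
qed

lemma schwinger_skew:
  assumes "A \<in> \<gg>\<ll>" "B \<in> \<gg>\<ll>"
  shows "schwinger_cocycle Hp Hm A B = - schwinger_cocycle Hp Hm B A"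
  by (simp add: schwinger_eq_pairing assms)

lemma schwinger_linear_left:
  assumes A: "A \<in> \<gg>\<ll>" and B: "B \<in> \<gg>\<ll>" and C: "C \<in> \<gg>\<ll>"
  shows "schwinger_cocycle Hp Hm (A + B) C = schwinger_cocycle Hp Hm A C + schwinger_cocycle Hp Hm B C"
    and "schwinger_cocycle Hp Hm (r *\<^sub>R A) C = of_real r * schwinger_cocycle Hp Hm A C"
proof -
  have fn: "mp (A + B) = (\<lambda>x. mp A x + mp B x)" "pm (A + B) = (\<lambda>x. pm A x + pm B x)"
    "mp (r *\<^sub>R A) = (\<lambda>x. r *\<^sub>R mp A x)" "pm (r *\<^sub>R A) = (\<lambda>x. r *\<^sub>R pm A x)"
    by (simp_all add: fun_eq_iff block_linear)
  show "schwinger_cocycle Hp Hm (A + B) C = schwinger_cocycle Hp Hm A C + schwinger_cocycle Hp Hm B C"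
    unfolding schwinger_eq_pairing[OF gl_res_closed(1)[OF A B] C] schwinger_eq_pairing[OF A C]
      schwinger_eq_pairing[OF B C] fn
      pairing_add_left[OF gl_resD(2)[OF C] gl_resD(3)[OF A] gl_resD(3)[OF B]]
      pairing_add_right[OF gl_resD(2)[OF A] gl_resD(2)[OF B] gl_resD(3)[OF C]]
    by (simp only: add_diff_add)
  show "schwinger_cocycle Hp Hm (r *\<^sub>R A) C = of_real r * schwinger_cocycle Hp Hm A C"
    unfolding schwinger_eq_pairing[OF gl_res_closed(2)[OF A B] C] schwinger_eq_pairing[OF A C] fn
      pairing_scaleR(1)[OF gl_resD(3)[OF A]] pairing_scaleR(2)[OF gl_resD(3)[OF C]]
    by (simp only: right_diff_distrib)
qed

text \<open>In normal form the cyclic sum has twenty-four terms, which cancel in pairs.\<close>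

lemma schwinger_jacobi:
  assumes A: "A \<in> \<gg>\<ll>" and B: "B \<in> \<gg>\<ll>" and C: "C \<in> \<gg>\<ll>"
  shows "schwinger_cocycle Hp Hm (bracket A B) C + schwinger_cocycle Hp Hm (bracket B C) A
    + schwinger_cocycle Hp Hm (bracket C A) B = 0"
  unfolding schwinger_eq_pairing[OF gl_res_closed(3)[OF A B] C]
    schwinger_eq_pairing[OF gl_res_closed(3)[OF B C] A]
    schwinger_eq_pairing[OF gl_res_closed(3)[OF C A] B]
    pairing_bracket[OF A B C] pairing_bracket[OF B C A] pairing_bracket[OF C A B]
  by simp

theorem lie_2_cocycle_schwinger: "lie_2_cocycle (gl_res Hp Hm) (schwinger_cocycle Hp Hm)"
proof -
  have ops: "lie_add (gl_res Hp Hm) = (+)" "lie_scale (gl_res Hp Hm) = (*\<^sub>R)"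
    "lie_bracket (gl_res Hp Hm) = (\<lambda>A B. bracket A B)"
    by (simp_all add: gl_res_def)
  let ?c = "schwinger_cocycle Hp Hm"
  have right: "?c C (A + B) = ?c C A + ?c C B" "?c C (r *\<^sub>R A) = of_real r * ?c C A"
    if A: "A \<in> \<gg>\<ll>" and B: "B \<in> \<gg>\<ll>" and C: "C \<in> \<gg>\<ll>" for A B C r
    using schwinger_linear_left[OF A B C] schwinger_skew[OF C A] schwinger_skew[OF C B]
      schwinger_skew[OF C gl_res_closed(1)[OF A B]] schwinger_skew[OF C gl_res_closed(2)[OF A B]]
    by simp_all
  show ?thesis
    unfolding lie_2_cocycle_def ops
  proof (intro conjI ballI allI)
    fix x y assume xy: "x \<in> \<gg>\<ll>" "y \<in> \<gg>\<ll>"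
    show "?c x y = - ?c y x" by (rule schwinger_skew[OF xy])
    show "?c (r *\<^sub>R x) y = of_real r * ?c x y" for r
      by (rule schwinger_linear_left(2)[OF xy(1,1,2)])
    show "?c x (r *\<^sub>R y) = of_real r * ?c x y" for r
      by (rule right(2)[OF xy(2,2,1)])
    fix w assume w: "w \<in> \<gg>\<ll>"
    show "?c (x + y) w = ?c x w + ?c y w" by (rule schwinger_linear_left(1)[OF xy w])
    show "?c w (x + y) = ?c w x + ?c w y" by (rule right(1)[OF xy w])
    show "?c (bracket x y) w + ?c (bracket y w) x + ?c (bracket w x) y = 0"
      by (rule schwinger_jacobi[OF xy w])
  qed
qed

end

section \<open>Pullback along a morphism\<close>

lemma lie_2_cocycle_pullback:
  assumes "lie_2_cocycle M c" and "lie_morphism L M \<phi>"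
  shows "lie_2_cocycle L (\<lambda>x y. c (\<phi> x) (\<phi> y))"
proof -
  let ?C = "lie_carrier L" and ?D = "lie_carrier M"
  have m: "\<phi> x \<in> ?D" "\<phi> (lie_add L x y) = lie_add M (\<phi> x) (\<phi> y)"
    "\<phi> (lie_bracket L x y) = lie_bracket M (\<phi> x) (\<phi> y)"
    "\<phi> (lie_scale L r x) = lie_scale M r (\<phi> x)" if "x \<in> ?C" "y \<in> ?C" for x y r
    using assms(2) that unfolding lie_morphism_def by auto
  note c = assms(1)[unfolded lie_2_cocycle_def]
  note skew = c[THEN conjunct1, rule_format]
    and add = c[THEN conjunct2, THEN conjunct1, rule_format]
    and scale = c[THEN conjunct2, THEN conjunct2, THEN conjunct1, rule_format]
    and jacobi = c[THEN conjunct2, THEN conjunct2, THEN conjunct2, rule_format]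
  show ?thesis
    unfolding lie_2_cocycle_def
  proof (intro conjI ballI allI)
    fix x y assume xy: "x \<in> ?C" "y \<in> ?C"
    show "c (\<phi> x) (\<phi> y) = - c (\<phi> y) (\<phi> x)" by (intro skew m(1)[OF _ xy(1)] xy)
    show "c (\<phi> (lie_scale L r x)) (\<phi> y) = of_real r * c (\<phi> x) (\<phi> y)"
      and "c (\<phi> x) (\<phi> (lie_scale L r y)) = of_real r * c (\<phi> x) (\<phi> y)" for r
      using scale[of "\<phi> x" "\<phi> y"] by (simp_all only: m[OF xy] m[OF xy(2,1)] simp_thms)
    fix w assume w: "w \<in> ?C"
    show "c (\<phi> (lie_add L x y)) (\<phi> w) = c (\<phi> x) (\<phi> w) + c (\<phi> y) (\<phi> w)"
      and "c (\<phi> w) (\<phi> (lie_add L x y)) = c (\<phi> w) (\<phi> x) + c (\<phi> w) (\<phi> y)"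
      using add[of "\<phi> x" "\<phi> y" "\<phi> w"] by (simp_all only: m[OF xy] m[OF xy(2,1)] m[OF w w] simp_thms)
    show "c (\<phi> (lie_bracket L x y)) (\<phi> w) + c (\<phi> (lie_bracket L y w)) (\<phi> x)
        + c (\<phi> (lie_bracket L w x)) (\<phi> y) = 0"
      using jacobi[of "\<phi> x" "\<phi> y" "\<phi> w"]
      by (simp only: m[OF xy] m[OF xy(2) w] m[OF w xy(1)] simp_thms)
  qed
qed

theorem proposition11p6:
  fixes G :: "'g monoid" and X :: "'g diffeological_space"
    and scl :: "complex \<Rightarrow> 'v::ab_group_add \<Rightarrow> 'v"
    and F :: "(nat \<Rightarrow> real \<times> 'g) set \<Rightarrow> 'v set"
    and E :: "((nat \<Rightarrow> real \<times> 'g) set \<times> 'v) diffeological_space"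
    and L :: "(('g \<Rightarrow> real) \<Rightarrow> real) \<Rightarrow> ((nat \<Rightarrow> real \<times> 'g) set \<Rightarrow> 'v) \<Rightarrow> (nat \<Rightarrow> real \<times> 'g) set \<Rightarrow> 'v"
    and D :: "((nat \<Rightarrow> real \<times> 'g) set \<Rightarrow> 'v) \<Rightarrow> (nat \<Rightarrow> real \<times> 'g) set \<Rightarrow> 'v"
    and \<Gamma> :: "((nat \<Rightarrow> real \<times> 'g) set \<Rightarrow> 'v) set"
    and \<iota> :: "((nat \<Rightarrow> real \<times> 'g) set \<Rightarrow> 'v) \<Rightarrow> 'h::complex_hilbert"
    and Hp Hm :: "'h set"
  assumes "regular_diffeological_lie_group G X"
    and "clifford_module (milnor_sphere G X) scl F E q c"
    and "dirac_type (milnor_sphere G X) scl E c D"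
    and "lie_derivatives G X scl E L"
    and "hilbert_module (milnor_sphere G X) scl E \<Gamma> \<iota>"
    and "polarization Hp Hm"
    and "\<forall>\<xi>\<in>lie_carrier (lie_of G X). \<exists>T\<in>lie_carrier (gl_res Hp Hm).
           extends_to \<Gamma> \<iota> (op_commutator (L \<xi>) D) T"
    and "lie_morphism (lie_of G X) (gl_res Hp Hm) (defect \<Gamma> \<iota> L D)"
  shows "lie_2_cocycle (lie_of G X) (defect_cocycle Hp Hm \<Gamma> \<iota> L D)"
  using lie_2_cocycle_pullback[OF lie_2_cocycle_schwinger[OF assms(6)] assms(8)]
  unfolding defect_cocycle_def .

end
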